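(* Suppose $F:\mathbb{R}^d\to\mathbb{R}^d$ is monotone and $\alpha$-symmetric $(L_0,L_1)$-Lipschitz with $\alpha\in(0,1)$, and $F(x_* )=0$. Then the extragradient method with $$\gamma_k=\omega_k=\frac1{2\sqrt2K_0+\left(2\sqrt2K_1+2^{\frac{3(1-\alpha)}2}K_2^{1-\alpha}\right)\|F(x_k)\|^\alpha}$$ satisfies, for all $K\ge0$, $$\min_{0\le k\le K}\|F(x_k)\|^2\le\frac{16\left(K_0+\left(K_1+2^{-\frac32}K_2^{1-\alpha}\right)\left(K_0+K_2\|x_0-x_*\|^{\frac\alpha{1-\alpha}}\right)^\alpha\|x_0-x_*\|^\alpha\right)^2\|x_0-x_*\|^2}{K+1}.$$
   Context: Extragradient method (EG): $\hat x_k=x_k-\gamma_kF(x_k)$, $x_{k+1}=x_k-\omega_kF(\hat x_k)$, started from $x_0\in\mathbb{R}^d$. $F$ is $\alpha$-symmetric $(L_0,L_1)$-Lipschitz ($L_0,L_1\ge0$) if for all $x,y$: $\|F(x)-F(y)\|\le\left(L_0+L_1\max_{\theta\in[0,1]}\|F(\theta x+(1-\theta)y)\|^\alpha\right)\|x-y\|$. Constants: $K_0=L_0\left(2^{\frac{\alpha^2}{1-\alpha}}+1\right)$, $K_1=L_1\cdot2^{\frac{\alpha^2}{1-\alpha}}$, $K_2=L_1^{\frac1{1-\alpha}}\cdot2^{\frac{\alpha^2}{1-\alpha}}\cdot3^\alpha(1-\alpha)^{\frac\alpha{1-\alpha}}$. Monotone: $\langle F(x)-F(y),x-y\rangle\ge0$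 for all $x,y$. *)

theory Defs
  imports "HOL-Analysis.Analysis"
begin

definition monotone_operator :: "(real ^ 'd \<Rightarrow> real ^ 'd) \<Rightarrow> bool" where
  "monotone_operator F \<longleftrightarrow> (\<forall>x y. (F x - F y) \<bullet> (x - y) \<ge> 0)"

text \<open>The number \<open>m\<close> is the maximum of \<open>g\<close> on \<open>S\<close>. The maximum has to be attained; an unbounded
  \<open>g\<close> has no maximum, whereas \<open>Sup\<close> on the reals would return an unspecified value.\<close>

definition is_max_on :: "('a \<Rightarrow> real) \<Rightarrow> 'a set \<Rightarrow> real \<Rightarrow> bool" where
  "is_max_on g S m \<longleftrightarrow> m \<in> g ` S \<and> (\<forall>t\<in>S. g t \<le> m)"

definition alpha_symmetric_Lipschitz ::
    "real \<Rightarrow> real \<Rightarrow> real \<Rightarrow> (real ^ 'd \<Rightarrow> real ^ 'd) \<Rightarrow> bool" where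
  "alpha_symmetric_Lipschitz \<alpha> L0 L1 F \<longleftrightarrow> L0 \<ge> 0 \<and> L1 \<ge> 0 \<and>
     (\<forall>x y. \<exists>m. is_max_on (\<lambda>\<theta>. norm (F (\<theta> *\<^sub>R x + (1 - \<theta>) *\<^sub>R y)) powr \<alpha>) {0..1} m \<and>
        norm (F x - F y) \<le> (L0 + L1 * m) * norm (x - y))"

definition K0_const :: "real \<Rightarrow> real \<Rightarrow> real" where
  "K0_const \<alpha> L0 = L0 * (2 powr (\<alpha>\<^sup>2 / (1 - \<alpha>)) + 1)"

definition K1_const :: "real \<Rightarrow> real \<Rightarrow> real" where
  "K1_const \<alpha> L1 = L1 * 2 powr (\<alpha>\<^sup>2 / (1 - \<alpha>))"

definition K2_const :: "real \<Rightarrow> real \<Rightarrow> real" where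
  "K2_const \<alpha> L1 =
     L1 powr (1 / (1 - \<alpha>)) * 2 powr (\<alpha>\<^sup>2 / (1 - \<alpha>)) * 3 powr \<alpha> * (1 - \<alpha>) powr (\<alpha> / (1 - \<alpha>))"

text \<open>The sequence \<open>x\<close> is generated by the extragradient method with step sizes \<open>\<gamma>\<close>, \<open>\<omega>\<close>,
  started from \<open>x 0\<close>. The step sizes are sequences, so that they may depend on the iterates.\<close>

definition extragradient ::
    "(real ^ 'd \<Rightarrow> real ^ 'd) \<Rightarrow> (nat \<Rightarrow> real) \<Rightarrow> (nat \<Rightarrow> real) \<Rightarrow> (nat \<Rightarrow> real ^ 'd) \<Rightarrow> bool" where
  "extragradient F \<gamma> \<omega> x \<longleftrightarrow>
     (\<forall>k. let xh = x k - \<gamma> k *\<^sub>R F (x k) in x (Suc k) = x k - \<omega> k *\<^sub>R F xh)"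

end

theory Submission
  imports Defs
begin

text \<open>
  The classical analysis has three ingredients. First, the symmetric Lipschitz condition yields an
  explicit local Lipschitz bound in terms of \<open>\<parallel>F y\<parallel>\<close> and the distance, hence a bound for \<open>\<parallel>F\<parallel>\<close> on the
  ball of radius \<open>R = \<parallel>x 0 - xs\<parallel>\<close> around the zero \<open>xs\<close> (\<open>alpha_symmetric_Lipschitz_explicit\<close>).
  Secondly, the step size is so short that \<open>\<gamma> F\<close> is a contraction near the current iterate, at the
  scale of one step (\<open>extragradient_local_contraction\<close>). Thirdly, monotonicity then gives
  \<open>\<parallel>x' - xs\<parallel>\<^sup>2 \<le> \<parallel>x - xs\<parallel>\<^sup>2 - c \<gamma>\<^sup>2 \<parallel>F x\<parallel>\<^sup>2\<close>, and summation bounds \<open>g\<^sup>2 min \<parallel>F\<parallel>\<^sup>2\<close> by \<open>R\<^sup>2 / (c (K + 1))\<close>, where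
  \<open>g\<close> is a lower bound of the step sizes.

  This sum does not give the constant of the theorem. The bracket of the bound carries
  \<open>2\<^sup>-\<^sup>3\<^sup>/\<^sup>2 K2\<^sup>1\<^sup>-\<^sup>\<alpha>\<close>, whereas \<open>1 / g\<close> carries \<open>2\<^sup>-\<^sup>3\<^sup>\<alpha>\<^sup>/\<^sup>2 K2\<^sup>1\<^sup>-\<^sup>\<alpha>\<close> in the same place, up to the factor
  \<open>2 sqrt 2\<close>. The quotient of \<open>1 / (2 sqrt 2 g)\<close> and the bracket is at most \<open>3 / 2\<close> (\<open>stepsize_coefficient_bounds\<close>), which
  leaves the claim \<open>9 / 8 (K + 1) g\<^sup>2 \<parallel>F (x K)\<parallel>\<^sup>2 \<le> R\<^sup>2\<close>; for \<open>K0 = 0\<close> and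
  \<open>\<alpha>\<close> tending to \<open>0\<close> the quotient approaches \<open>1.477\<close>, more than the factor \<open>sqrt 2\<close> that even \<open>c = 1\<close>
  would permit, so the descent inequality alone is too weak.

  The descent inequality is nearly an equality only if the iterates circle around \<open>xs\<close>, with
  \<open>F\<close> orthogonal to \<open>x - xs\<close>. To stay orthogonal, \<open>F\<close> has to turn at every step, and
  for a monotone operator each turn decreases \<open>\<parallel>F\<parallel>\<close>: one has
  \<open>\<parallel>F x'\<parallel>\<^sup>2 \<le> \<parallel>F x\<parallel>\<^sup>2 - (8 / 9) \<parallel>F xh - F x\<parallel>\<^sup>2\<close>. The potential in
  \<open>potential_step_scalar\<close>, a combination of \<open>\<parallel>x - xs\<parallel>\<^sup>2\<close>, \<open>\<langle>F x, x - xs\<rangle>\<close> and \<open>\<parallel>F x\<parallel>\<^sup>2\<close> with weights depending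
  on \<open>k\<close>, makes this quantitative and shows that \<open>g\<^sup>2 \<parallel>F\<parallel>\<^sup>2\<close> decays like \<open>R\<^sup>2 / (7 / 6 K)\<close>
  (\<open>extragradient_last_iterate_rate\<close>). Since \<open>\<parallel>F\<parallel>\<close> never increases, the minimum in the theorem may be
  replaced by the value at the last iterate.
\<close>

section \<open>Powers with exponent below one\<close>

text \<open>
  The concave power lies below its tangent at \<open>z\<close>; this is Young's inequality divided by
  \<open>z powr \<alpha>\<close>.
\<close>

lemma powr_tangent_line:
  fixes z z' \<alpha> :: real
  assumes "0 < z" and "0 < z'" and "0 < \<alpha>" and "\<alpha> < 1"
  shows "z' powr (1 - \<alpha>) \<le> z powr (1 - \<alpha>) + (1 - \<alpha>) * (z' - z) / z powr \<alpha>"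
proof -
  have "z' powr (1 - \<alpha>) * z powr \<alpha> \<le> (1 - \<alpha>) * z' + \<alpha> * z"
    using assms by (intro Youngs_inequality_0) auto
  also have "\<dots> = z powr (1 - \<alpha>) * z powr \<alpha> + (1 - \<alpha>) * (z' - z)"
    using assms by (simp add: powr_add [symmetric] algebra_simps)
  finally show ?thesis
    using assms by (simp add: field_simps)
qed

text \<open>
  Concavity of the power at the midpoint, in homogeneous form. The factor is sharp at
  \<open>a = b\<close>; read with exponent \<open>1 - \<alpha>\<close> and then raised to the power \<open>\<alpha> / (1 - \<alpha>)\<close> it
  produces the factor \<open>2 powr (\<alpha>\<^sup>2 / (1 - \<alpha>))\<close> of \<open>K0\<close>, \<open>K1\<close> and \<open>K2\<close>.
\<close>

lemma powr_sum_le_powr_of_sum: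
  fixes a b \<theta> :: real
  assumes "0 \<le> a" and "0 \<le> b" and "0 < \<theta>" and "\<theta> < 1"
  shows "a powr \<theta> + b powr \<theta> \<le> 2 powr (1 - \<theta>) * (a + b) powr \<theta>"
proof (cases "a = 0 \<or> b = 0")
  case True
  have "1 \<le> (2::real) powr (1 - \<theta>)" using assms by (simp add: ge_one_powr_ge_zero)
  then show ?thesis using True assms
    by (auto simp: mult_le_cancel_right1 not_less)
next
  case False
  define s where "s = a + b"
  have pos: "a > 0" "b > 0" "s > 0" using False assms by (auto simp: s_def)
  have part: "(t / s) powr \<theta> * (1 / 2) powr (1 - \<theta>) \<le> \<theta> * (t / s) + (1 - \<theta>) * (1 / 2)"
    if "t > 0" for t
    using that pos assms by (intro Youngs_inequality_0) auto
  have "((a / s) powr \<theta> + (b / s) powr \<theta>) * (1 / 2) powr (1 - \<theta>)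
      \<le> \<theta> * (a / s + b / s) + (1 - \<theta>)"
    unfolding distrib_right distrib_left
    using add_mono [OF part [OF pos(1)] part [OF pos(2)]] by simp
  also have "a / s + b / s = 1" using pos by (simp add: s_def add_divide_distrib [symmetric])
  finally have "((a / s) powr \<theta> + (b / s) powr \<theta>) * (1 / 2) powr (1 - \<theta>) \<le> 1" by simp
  then show ?thesis using pos
    by (simp add: powr_divide s_def field_simps)
qed

lemma powr_of_sum_le_powr_sum:
  fixes a b \<theta> :: real
  assumes "0 \<le> a" and "0 \<le> b" and "0 < \<theta>" and "\<theta> < 1"
  shows "(a + b) powr \<theta> \<le> a powr \<theta> + b powr \<theta>"
proof (cases "a + b = 0")
  case False
  define s where "s = a + b"
  have s: "s > 0" using False assms by (simp add: s_def)
  have "t / s \<le> (t / s) powr \<theta>" if "0 \<le> t" "t \<le> s" for t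
  proof (cases "t = 0")
    case False
    then have "(t / s) powr 1 \<le> (t / s) powr \<theta>"
      using that s assms by (intro powr_mono') auto
    then show ?thesis using that s by simp
  qed simp
  from this [of a] this [of b] have "a / s + b / s \<le> (a / s) powr \<theta> + (b / s) powr \<theta>"
    using assms by (auto simp: s_def)
  moreover have "a / s + b / s = 1" using s by (simp add: s_def add_divide_distrib [symmetric])
  ultimately show ?thesis using s assms
    by (simp add: powr_divide s_def field_simps)
qed (use assms in auto)

section \<open>Growth of symmetrically Lipschitz operators\<close>

text \<open>
  Because \<open>\<alpha> > 0\<close>, a point that maximises \<open>\<parallel>F\<parallel>\<^sup>\<alpha>\<close> on the segment also maximises \<open>\<parallel>F\<parallel>\<close>.
\<close>

lemma alpha_symmetric_Lipschitz_segment: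
  assumes "alpha_symmetric_Lipschitz \<alpha> L0 L1 F" and "0 < \<alpha>"
  obtains w where "w \<in> closed_segment x y"
    and "\<And>z. z \<in> closed_segment x y \<Longrightarrow> norm (F z) \<le> norm (F w)"
    and "norm (F x - F y) \<le> (L0 + L1 * norm (F w) powr \<alpha>) * norm (x - y)"
proof -
  obtain m where m: "is_max_on (\<lambda>\<theta>. norm (F (\<theta> *\<^sub>R x + (1 - \<theta>) *\<^sub>R y)) powr \<alpha>) {0..1} m"
    and le: "norm (F x - F y) \<le> (L0 + L1 * m) * norm (x - y)"
    using assms(1) unfolding alpha_symmetric_Lipschitz_def by blast
  have seg: "closed_segment x y = (\<lambda>\<theta>. \<theta> *\<^sub>R x + (1 - \<theta>) *\<^sub>R y) ` {0..1}"
    by (subst closed_segment_commute) (auto simp: closed_segment_def image_iff add.commute)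
  from m obtain w where w: "w \<in> closed_segment x y" "m = norm (F w) powr \<alpha>"
    unfolding is_max_on_def seg by auto
  have "norm (F z) \<le> norm (F w)" if "z \<in> closed_segment x y" for z
  proof -
    have "norm (F z) powr \<alpha> \<le> norm (F w) powr \<alpha>"
      using that m w(2) unfolding is_max_on_def seg by auto
    then show ?thesis using assms(2) by (metis norm_ge_zero not_le powr_less_mono2)
  qed
  with w le that show ?thesis by blast
qed

text \<open>
  A discrete Gronwall argument for \<open>f' \<le> A (c\<^sup>\<alpha> + f\<^sup>\<alpha>)\<close>. Since
  \<open>c\<^sup>\<alpha> + f\<^sup>\<alpha> \<le> 2\<^sup>1\<^sup>-\<^sup>\<alpha> (f + c)\<^sup>\<alpha>\<close>, the quantity \<open>(f + c)\<^sup>1\<^sup>-\<^sup>\<alpha>\<close> grows at most linearly. The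
  hypothesis evaluates \<open>f\<close> at an unknown intermediate point \<open>w\<close> instead of at the left end
  point; on a fine grid, uniform continuity absorbs this error in the passage from
  \<open>2\<^sup>1\<^sup>-\<^sup>\<alpha>\<close> to \<open>3\<^sup>1\<^sup>-\<^sup>\<alpha>\<close>.
\<close>

lemma gronwall_powr:
  fixes f :: "real \<Rightarrow> real" and \<alpha> A c :: real
  assumes \<alpha>: "0 < \<alpha>" "\<alpha> < 1" and c: "0 < c" and A: "0 \<le> A"
    and cont: "continuous_on {0..1} f" and nonneg: "\<And>t. 0 \<le> f t"
    and growth: "\<And>s t. 0 \<le> s \<Longrightarrow> s \<le> t \<Longrightarrow> t \<le> 1 \<Longrightarrow>
       \<exists>w\<in>{s..t}. f t \<le> f s + (t - s) * A * (c powr \<alpha> + f w powr \<alpha>)"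
  shows "(f 1 + c) powr (1 - \<alpha>) \<le> (f 0 + c) powr (1 - \<alpha>) + (1 - \<alpha>) * 3 powr (1 - \<alpha>) * A"
proof -
  define \<eta> where "\<eta> = (3 powr (1 - \<alpha>) - 2 powr (1 - \<alpha>)) * c powr \<alpha>"
  have pow23: "2 powr (1 - \<alpha>) < (3::real) powr (1 - \<alpha>)"
    using \<alpha> by (intro powr_less_mono2) auto
  then have "\<eta> > 0" using c by (simp add: \<eta>_def)
  have "continuous_on {0..1} (\<lambda>t. f t powr \<alpha>)"
    using cont nonneg \<alpha> by (intro continuous_on_powr') auto
  then have "uniformly_continuous_on {0..1} (\<lambda>t. f t powr \<alpha>)"
    by (rule compact_uniformly_continuous) simp
  then obtain \<delta> where "\<delta> > 0" and
    \<delta>: "\<And>s t. s \<in> {0..1} \<Longrightarrow> t \<in> {0..1} \<Longrightarrow> dist t s < \<delta> \<Longrightarrow> dist (f t powr \<alpha>) (f s powr \<alpha>) < \<eta>"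
    using \<open>\<eta> > 0\<close> unfolding uniformly_continuous_on_def by metis
  obtain n :: nat where n: "n > 0" "1 / real n < \<delta>"
    using \<open>\<delta> > 0\<close> by (metis nat_approx_posE zero_less_Suc)
  define M where "M = (1 - \<alpha>) * 3 powr (1 - \<alpha>) * A"
  have step: "(f t + c) powr (1 - \<alpha>) \<le> (f s + c) powr (1 - \<alpha>) + M * (t - s)"
    if st: "0 \<le> s" "s \<le> t" "t \<le> 1" "t - s < \<delta>" for s t
  proof -
    obtain w where w: "w \<in> {s..t}" "f t \<le> f s + (t - s) * A * (c powr \<alpha> + f w powr \<alpha>)"
      using growth st by blast
    have "dist (f w powr \<alpha>) (f s powr \<alpha>) < \<eta>"
      using st w by (intro \<delta>) (auto simp: dist_real_def)
    then have "c powr \<alpha> + f w powr \<alpha> \<le> (f s powr \<alpha> + c powr \<alpha>) + \<eta>"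
      by (simp add: dist_real_def abs_less_iff)
    also have "\<dots> \<le> 2 powr (1 - \<alpha>) * (f s + c) powr \<alpha> + (3 powr (1 - \<alpha>) - 2 powr (1 - \<alpha>)) * (f s + c) powr \<alpha>"
      unfolding \<eta>_def using \<alpha> c nonneg [of s] pow23
      by (intro add_mono powr_sum_le_powr_of_sum mult_left_mono powr_mono2) auto
    also have "\<dots> = 3 powr (1 - \<alpha>) * (f s + c) powr \<alpha>" by (simp add: algebra_simps)
    finally have "(t - s) * A * (c powr \<alpha> + f w powr \<alpha>) \<le> (t - s) * A * (3 powr (1 - \<alpha>) * (f s + c) powr \<alpha>)"
      using st A by (intro mult_left_mono) auto
    then have rise: "f t - f s \<le> (t - s) * A * 3 powr (1 - \<alpha>) * (f s + c) powr \<alpha>"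
      using w(2) by (simp add: algebra_simps)
    have zpos: "f s + c > 0" "f t + c > 0" using nonneg [of s] nonneg [of t] c by linarith+
    have "(f t + c) powr (1 - \<alpha>) \<le> (f s + c) powr (1 - \<alpha>) + (1 - \<alpha>) * ((f t + c) - (f s + c)) / (f s + c) powr \<alpha>"
      using zpos \<alpha> by (rule powr_tangent_line)
    also have "\<dots> \<le> (f s + c) powr (1 - \<alpha>)
        + (1 - \<alpha>) * ((t - s) * A * 3 powr (1 - \<alpha>) * (f s + c) powr \<alpha>) / (f s + c) powr \<alpha>"
      using rise \<alpha> zpos by (intro add_left_mono divide_right_mono mult_left_mono) auto
    also have "\<dots> = (f s + c) powr (1 - \<alpha>) + M * (t - s)"
      using zpos by (simp add: M_def)
    finally show ?thesis .
  qed
  have "(f (real i / real n) + c) powr (1 - \<alpha>) \<le> (f 0 + c) powr (1 - \<alpha>) + M * (real i / real n)"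
    if "i \<le> n" for i
    using that
  proof (induction i)
    case (Suc i)
    have "(f (real (Suc i) / real n) + c) powr (1 - \<alpha>)
      \<le> (f (real i / real n) + c) powr (1 - \<alpha>) + M * (real (Suc i) / real n - real i / real n)"
      using Suc.prems n by (intro step) (auto simp: field_simps)
    then show ?case using Suc by (simp add: algebra_simps)
  qed simp
  from this [of n] n show ?thesis by (simp add: M_def)
qed

text \<open>
  The Gronwall estimate applied to \<open>\<parallel>F\<parallel>\<close> along the segment from \<open>y\<close> to \<open>x\<close>. The shift \<open>c\<close>
  hides the constant part: with \<open>L0 \<le> L1 c\<^sup>\<alpha>\<close> the local Lipschitz constant is at most
  \<open>L1 (c\<^sup>\<alpha> + \<parallel>F\<parallel>\<^sup>\<alpha>)\<close>.
\<close>

lemma alpha_symmetric_Lipschitz_growth: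
  fixes F :: "real ^ 'd \<Rightarrow> real ^ 'd"
  assumes lip: "alpha_symmetric_Lipschitz \<alpha> L0 L1 F" and \<alpha>: "0 < \<alpha>" "\<alpha> < 1"
    and c: "0 < c" "L0 \<le> L1 * c powr \<alpha>"
  shows "(norm (F x) + c) powr (1 - \<alpha>)
    \<le> (norm (F y) + c) powr (1 - \<alpha>) + (1 - \<alpha>) * 3 powr (1 - \<alpha>) * (norm (x - y) * L1)"
proof -
  have L: "0 \<le> L0" "0 \<le> L1" using lip by (auto simp: alpha_symmetric_Lipschitz_def)
  define p where "p = (\<lambda>t. y + t *\<^sub>R (x - y))"
  define f where "f = (\<lambda>t. norm (F (p t)))"
  have p01: "p 0 = y" "p 1 = x" by (auto simp: p_def)
  have diff: "norm (p t - p s) = \<bar>t - s\<bar> * norm (x - y)" for s t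
  proof -
    have "p t - p s = (t - s) *\<^sub>R (x - y)" by (simp add: p_def scaleR_left_diff_distrib)
    then show ?thesis by simp
  qed
  have seg: "\<exists>u\<in>{s..t}. w = p u" if "s \<le> t" "w \<in> closed_segment (p t) (p s)" for s t w
  proof -
    from that(2) obtain v where v: "0 \<le> v" "v \<le> 1" "w = (1 - v) *\<^sub>R p s + v *\<^sub>R p t"
      by (subst (asm) closed_segment_commute) (auto simp: closed_segment_def)
    have "w = p (s + v * (t - s))" unfolding v(3) p_def
      by (simp add: algebra_simps)
    moreover have "v * (t - s) \<le> 1 * (t - s)" using v that by (intro mult_right_mono) auto
    ultimately show ?thesis using v that by (intro bexI [of _ "s + v * (t - s)"]) auto
  qed
  obtain w0 where w0: "\<And>z. z \<in> closed_segment x y \<Longrightarrow> norm (F z) \<le> norm (F w0)"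
    using alpha_symmetric_Lipschitz_segment [OF lip \<alpha>(1), of x y] by metis
  have p_seg: "p t \<in> closed_segment x y" if "t \<in> {0..1}" for t
    using that by (subst closed_segment_commute)
      (auto simp: closed_segment_def p_def algebra_simps intro!: exI [of _ t])
  define C where "C = (L0 + L1 * norm (F w0) powr \<alpha>) * norm (x - y)"
  have C: "0 \<le> C" using L by (simp add: C_def)
  have "C-lipschitz_on {0..1} f"
  proof (rule lipschitz_onI)
    fix s t :: real assume st: "s \<in> {0..1}" "t \<in> {0..1}"
    obtain w where w: "w \<in> closed_segment (p s) (p t)"
      "norm (F (p s) - F (p t)) \<le> (L0 + L1 * norm (F w) powr \<alpha>) * norm (p s - p t)"
      using alpha_symmetric_Lipschitz_segment [OF lip \<alpha>(1), of "p s" "p t"] by metis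
    have "w \<in> closed_segment x y"
      using w(1) closed_segment_subset [OF p_seg [OF st(1)] p_seg [OF st(2)] convex_closed_segment] by blast
    then have "(L0 + L1 * norm (F w) powr \<alpha>) * norm (p s - p t)
        \<le> (L0 + L1 * norm (F w0) powr \<alpha>) * norm (p s - p t)"
      using w0 L \<alpha> by (intro mult_right_mono add_left_mono mult_left_mono powr_mono2) auto
    also have "\<dots> = C * dist s t" unfolding diff by (simp add: C_def dist_real_def)
    finally show "dist (f s) (f t) \<le> C * dist s t"
      using w(2) norm_triangle_ineq3 [of "F (p s)" "F (p t)"]
      by (simp add: f_def dist_real_def)
  qed (use C in simp)
  then have cont: "continuous_on {0..1} f" by (rule lipschitz_on_continuous_on)
  have "(f 1 + c) powr (1 - \<alpha>) \<le> (f 0 + c) powr (1 - \<alpha>) + (1 - \<alpha>) * 3 powr (1 - \<alpha>) * (norm (x - y) * L1)"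
  proof (rule gronwall_powr [OF \<alpha> c(1) _ cont])
    fix s t :: real assume st: "0 \<le> s" "s \<le> t" "t \<le> 1"
    obtain w where w: "w \<in> closed_segment (p t) (p s)"
      "norm (F (p t) - F (p s)) \<le> (L0 + L1 * norm (F w) powr \<alpha>) * norm (p t - p s)"
      using alpha_symmetric_Lipschitz_segment [OF lip \<alpha>(1), of "p t" "p s"] by metis
    obtain u where u: "u \<in> {s..t}" "w = p u" using seg st w(1) by blast
    have "f t \<le> f s + norm (F (p t) - F (p s))"
      unfolding f_def using norm_triangle_ineq2 [of "F (p t)" "F (p s)"] by simp
    also have "\<dots> \<le> f s + (L1 * c powr \<alpha> + L1 * f u powr \<alpha>) * norm (p t - p s)"
      using w(2) c(2) unfolding u f_def
      by (intro add_left_mono order_trans [OF w(2) [unfolded u(2)]] mult_right_mono) auto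
    also have "\<dots> = f s + (t - s) * (norm (x - y) * L1) * (c powr \<alpha> + f u powr \<alpha>)"
      unfolding diff using st by (simp add: algebra_simps)
    finally show "\<exists>w\<in>{s..t}. f t \<le> f s + (t - s) * (norm (x - y) * L1) * (c powr \<alpha> + f w powr \<alpha>)"
      using u(1) by blast
  qed (use L in \<open>auto simp: f_def\<close>)
  then show ?thesis by (simp add: f_def p01)
qed

text \<open>
  The maximum over the segment is eliminated in favour of \<open>\<parallel>F y\<parallel>\<close> and the distance. The growth
  estimate bounds \<open>\<parallel>F\<parallel> + c\<close> at the maximiser by the \<open>1 / (1 - \<alpha>)\<close>-th power of a sum, and
  convexity followed by subadditivity of \<open>u \<mapsto> u\<^sup>\<alpha>\<close> separates the three contributions of
  \<open>\<parallel>F y\<parallel>\<close>, \<open>c\<close> and the distance, which become the terms with \<open>K1\<close>, \<open>K0\<close> and \<open>K2\<close>.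
\<close>

lemma alpha_symmetric_Lipschitz_explicit:
  fixes F :: "real ^ 'd \<Rightarrow> real ^ 'd"
  assumes lip: "alpha_symmetric_Lipschitz \<alpha> L0 L1 F" and \<alpha>: "0 < \<alpha>" "\<alpha> < 1"
  shows "norm (F x - F y) \<le> (K0_const \<alpha> L0 + K1_const \<alpha> L1 * norm (F y) powr \<alpha>
     + K2_const \<alpha> L1 * norm (x - y) powr (\<alpha> / (1 - \<alpha>))) * norm (x - y)"
proof -
  have L: "0 \<le> L0" "0 \<le> L1" using lip by (auto simp: alpha_symmetric_Lipschitz_def)
  define q where "q = (2::real) powr (\<alpha>\<^sup>2 / (1 - \<alpha>))"
  define r where "r = \<alpha> / (1 - \<alpha>)"
  define D where "D = norm (x - y)"
  have r: "0 < r" "r * (1 - \<alpha>) = \<alpha>" "1 / (1 - \<alpha>) * \<alpha> = r" "1 + r = 1 / (1 - \<alpha>)"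
    using \<alpha> by (auto simp: r_def field_simps)
  have q: "0 < q" "(2 powr \<alpha>) powr r = q"
    by (auto simp: q_def r_def powr_powr power2_eq_square)
  have D: "0 \<le> D" by (simp add: D_def)
  obtain w where w: "w \<in> closed_segment x y"
    "norm (F x - F y) \<le> (L0 + L1 * norm (F w) powr \<alpha>) * D"
    using alpha_symmetric_Lipschitz_segment [OF lip \<alpha>(1), of x y] unfolding D_def by metis
  show ?thesis
  proof (cases "L1 = 0")
    case True
    have "norm (F x - F y) \<le> L0 * D" using w True by simp
    also have "\<dots> \<le> L0 * (q + 1) * D"
      using L q D by (intro mult_right_mono) (auto simp: algebra_simps)
    finally show ?thesis using True
      by (simp add: K0_const_def K1_const_def K2_const_def q_def D_def)
  next
    case False
    then have L1: "0 < L1" using L by simp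
    define Y where "Y = (1 - \<alpha>) * 3 powr (1 - \<alpha>) * (D * L1)"
    define Z where "Z = Y powr (1 / (1 - \<alpha>))"
    have Y: "0 \<le> Y" using \<alpha> D L by (simp add: Y_def)
    have Z: "0 \<le> Z" "Z powr (1 - \<alpha>) = Y" "Z powr \<alpha> = Y powr r"
      using Y \<alpha> r by (auto simp: Z_def powr_powr)
    have "L1 * Y powr r = L1 powr (1 + r) * ((1 - \<alpha>) powr r * 3 powr \<alpha> * D powr r)"
      unfolding powr_add Y_def using \<alpha> D L1 r
      by (simp add: powr_mult powr_powr mult.commute [of _ r])
    then have Yr: "q * (L1 * Y powr r) = K2_const \<alpha> L1 * D powr r"
      by (simp add: K2_const_def q_def r(4)) (simp add: r_def)
    \<comment> \<open>A shift with \<open>L1 c\<^sup>\<alpha> = L0\<close> would vanish for \<open>L0 = 0\<close>, hence the detour over a slightly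
      larger constant \<open>L'\<close>, which tends to \<open>L0\<close> in the end.\<close>
    have bound: "norm (F x - F y) \<le> (L0 + q * L' + K1_const \<alpha> L1 * norm (F y) powr \<alpha>
         + K2_const \<alpha> L1 * D powr r) * D" if L': "L0 < L'" for L'
    proof -
      define c where "c = (L' / L1) powr (1 / \<alpha>)"
      have c: "0 < c" "L1 * c powr \<alpha> = L'"
        using L1 L L' \<alpha> by (auto simp: c_def powr_powr)
      have nw: "norm (w - y) \<le> D"
        using segment_bound [OF w(1)] by (simp add: D_def norm_minus_commute)
      have "(norm (F w) + c) powr (1 - \<alpha>)
          \<le> (norm (F y) + c) powr (1 - \<alpha>) + (1 - \<alpha>) * 3 powr (1 - \<alpha>) * (norm (w - y) * L1)"
        using L' c by (intro alpha_symmetric_Lipschitz_growth [OF lip \<alpha>]) auto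
      also have "\<dots> \<le> (norm (F y) + c) powr (1 - \<alpha>) + Z powr (1 - \<alpha>)"
        unfolding Z Y_def using nw \<alpha> L by (intro add_left_mono mult_left_mono mult_right_mono) auto
      also have "\<dots> \<le> 2 powr (1 - (1 - \<alpha>)) * (norm (F y) + c + Z) powr (1 - \<alpha>)"
        using c Z \<alpha> by (intro powr_sum_le_powr_of_sum) auto
      finally have "((norm (F w) + c) powr (1 - \<alpha>)) powr r
          \<le> (2 powr \<alpha> * (norm (F y) + c + Z) powr (1 - \<alpha>)) powr r"
        using r by (intro powr_mono2) auto
      then have "(norm (F w) + c) powr \<alpha> \<le> q * (norm (F y) + c + Z) powr \<alpha>"
        using q by (simp add: powr_mult powr_powr mult.commute [of _ r] r)
      moreover have "norm (F w) powr \<alpha> \<le> (norm (F w) + c) powr \<alpha>"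
        using c \<alpha> by (intro powr_mono2) auto
      moreover have "(norm (F y) + c + Z) powr \<alpha> \<le> norm (F y) powr \<alpha> + c powr \<alpha> + Y powr r"
        using powr_of_sum_le_powr_sum [of "norm (F y) + c" Z \<alpha>]
          powr_of_sum_le_powr_sum [of "norm (F y)" c \<alpha>] c Z \<alpha> by simp
      then have "q * (norm (F y) + c + Z) powr \<alpha> \<le> q * (norm (F y) powr \<alpha> + c powr \<alpha> + Y powr r)"
        using q by (intro mult_left_mono) auto
      ultimately have "norm (F w) powr \<alpha> \<le> q * (norm (F y) powr \<alpha> + c powr \<alpha> + Y powr r)"
        by linarith
      then have "L1 * norm (F w) powr \<alpha> \<le> L1 * (q * (norm (F y) powr \<alpha> + c powr \<alpha> + Y powr r))"
        using L by (intro mult_left_mono) auto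
      also have "\<dots> = q * (L1 * c powr \<alpha>) + L1 * q * norm (F y) powr \<alpha> + q * (L1 * Y powr r)"
        by (simp add: algebra_simps)
      also have "\<dots> = q * L' + K1_const \<alpha> L1 * norm (F y) powr \<alpha> + K2_const \<alpha> L1 * D powr r"
        unfolding c Yr by (simp add: K1_const_def q_def)
      finally have "(L0 + L1 * norm (F w) powr \<alpha>) * D
          \<le> (L0 + q * L' + K1_const \<alpha> L1 * norm (F y) powr \<alpha> + K2_const \<alpha> L1 * D powr r) * D"
        using D by (intro mult_right_mono) auto
      with w(2) show ?thesis by linarith
    qed
    have "norm (F x - F y) \<le> (K0_const \<alpha> L0 + K1_const \<alpha> L1 * norm (F y) powr \<alpha>
        + K2_const \<alpha> L1 * D powr r) * D"
    proof (rule field_le_epsilon)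
      fix e :: real assume e: "0 < e"
      define \<delta> where "\<delta> = e / (q * D + 1)"
      have pos: "0 < q * D + 1" using q D by (simp add: add_nonneg_pos)
      then have "\<delta> * (q * D + 1) = e" by (simp add: \<delta>_def)
      then have \<delta>: "\<delta> * (q * D) + \<delta> = e" by (simp add: distrib_left)
      have "0 < \<delta>" using e pos by (simp add: \<delta>_def)
      have "norm (F x - F y) \<le> (L0 + q * (L0 + \<delta>) + K1_const \<alpha> L1 * norm (F y) powr \<alpha>
         + K2_const \<alpha> L1 * D powr r) * D"
        using \<open>0 < \<delta>\<close> by (intro bound) auto
      also have "\<dots> = (K0_const \<alpha> L0 + K1_const \<alpha> L1 * norm (F y) powr \<alpha>
         + K2_const \<alpha> L1 * D powr r) * D + \<delta> * (q * D)"
        by (simp add: K0_const_def q_def algebra_simps)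
      finally show "norm (F x - F y) \<le> (K0_const \<alpha> L0 + K1_const \<alpha> L1 * norm (F y) powr \<alpha>
         + K2_const \<alpha> L1 * D powr r) * D + e"
        using \<delta> \<open>0 < \<delta>\<close> by linarith
    qed
    then show ?thesis by (simp add: D_def r_def)
  qed
qed

section \<open>Contraction at the scale of one step\<close>

text \<open>
  Bootstrapping on a ball of radius \<open>4 / 3 \<gamma> N\<close>: if \<open>u N\<close> is the maximum of \<open>\<parallel>F\<parallel>\<close> on a radius, with
  \<open>u \<ge> 1\<close>, then the Lipschitz constant there is at most \<open>u (L0 + L1 N\<^sup>\<alpha>)\<close>, so that
  \<open>u N \<le> N + u N / 3\<close> and \<open>u \<le> 3 / 2\<close>. The second smallness condition then makes \<open>\<gamma> F\<close> a
  \<open>1 / 3\<close>-contraction on the ball.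
\<close>

lemma alpha_symmetric_Lipschitz_near:
  fixes F :: "real ^ 'd \<Rightarrow> real ^ 'd" and x :: "real ^ 'd"
  defines "N \<equiv> norm (F x)"
  assumes lip: "alpha_symmetric_Lipschitz \<alpha> L0 L1 F" and \<alpha>: "0 < \<alpha>" "\<alpha> < 1"
    and N: "0 < N" and \<gamma>: "0 < \<gamma>"
    and small: "\<gamma> * (L0 + L1 * N powr \<alpha>) \<le> 1 / 4"
    and small': "\<gamma> * (L0 + L1 * (3 / 2 * N) powr \<alpha>) \<le> 1 / 3"
    and y: "y \<in> cball x (4 / 3 * \<gamma> * N)" and z: "z \<in> cball x (4 / 3 * \<gamma> * N)"
  shows "\<gamma> * norm (F y - F z) \<le> norm (y - z) / 3"
proof -
  let ?B = "cball x (4 / 3 * \<gamma> * N)"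
  have L: "0 \<le> L0" "0 \<le> L1" using lip by (auto simp: alpha_symmetric_Lipschitz_def)
  have bound: "norm (F p) \<le> 3 / 2 * N" if p: "p \<in> ?B" for p
  proof -
    obtain w where w: "w \<in> closed_segment p x"
      and w_max: "\<And>z. z \<in> closed_segment p x \<Longrightarrow> norm (F z) \<le> norm (F w)"
      using alpha_symmetric_Lipschitz_segment [OF lip \<alpha>(1), of p x] by metis
    obtain w' where w': "w' \<in> closed_segment w x"
      "norm (F w - F x) \<le> (L0 + L1 * norm (F w') powr \<alpha>) * norm (w - x)"
      using alpha_symmetric_Lipschitz_segment [OF lip \<alpha>(1), of w x] by metis
    have "w' \<in> closed_segment p x"
      using w'(1) closed_segment_subset [OF w ends_in_segment(2) convex_closed_segment] by blast
    then have w'_le: "norm (F w') \<le> norm (F w)" by (rule w_max)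
    define u where "u = norm (F w) / N"
    have Fw: "norm (F w) = u * N" using N by (simp add: u_def)
    have u1: "1 \<le> u" using w_max [of x] N by (simp add: u_def N_def)
    have "u powr \<alpha> \<le> u powr 1" using u1 \<alpha> by (intro powr_mono) auto
    then have ua: "u powr \<alpha> \<le> u" using u1 by simp
    have wx: "norm (w - x) \<le> 4 / 3 * \<gamma> * N"
      using segment_bound(2) [OF w] p by (simp add: dist_norm norm_minus_commute)
    have "L0 + L1 * norm (F w') powr \<alpha> \<le> L0 + L1 * norm (F w) powr \<alpha>"
      using w'_le L \<alpha> by (intro add_left_mono mult_left_mono powr_mono2) auto
    also have "\<dots> = 1 * L0 + u powr \<alpha> * (L1 * N powr \<alpha>)"
      using u1 N by (simp add: Fw powr_mult)
    also have "\<dots> \<le> u * L0 + u * (L1 * N powr \<alpha>)"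
      using u1 ua L by (intro add_mono mult_right_mono) auto
    finally have lw: "L0 + L1 * norm (F w') powr \<alpha> \<le> u * (L0 + L1 * N powr \<alpha>)"
      by (simp add: algebra_simps)
    have "norm (F w - F x) \<le> u * (L0 + L1 * N powr \<alpha>) * (4 / 3 * \<gamma> * N)"
      using u1 L N \<gamma> by (intro order_trans [OF w'(2)] mult_mono lw wx) auto
    also have "\<dots> = 4 / 3 * u * N * (\<gamma> * (L0 + L1 * N powr \<alpha>))" by simp
    also have "\<dots> \<le> 4 / 3 * u * N * (1 / 4)" using small u1 N by (intro mult_left_mono) auto
    finally have "norm (F w - F x) \<le> u * N / 3" by (simp add: mult.commute)
    then have "u * N \<le> N + u * N / 3"
      using norm_triangle_ineq2 [of "F w" "F x"] by (simp add: Fw N_def)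
    then have "norm (F w) \<le> 3 / 2 * N" by (simp add: Fw)
    then show ?thesis using w_max [of p] by simp
  qed
  obtain w where w: "w \<in> closed_segment y z"
    "norm (F y - F z) \<le> (L0 + L1 * norm (F w) powr \<alpha>) * norm (y - z)"
    using alpha_symmetric_Lipschitz_segment [OF lip \<alpha>(1), of y z] by metis
  have "w \<in> ?B" using w(1) closed_segment_subset [OF y z convex_cball] by blast
  then have "(L0 + L1 * norm (F w) powr \<alpha>) * norm (y - z)
      \<le> (L0 + L1 * (3 / 2 * N) powr \<alpha>) * norm (y - z)"
    using bound L \<alpha> by (intro mult_right_mono add_left_mono mult_left_mono powr_mono2) auto
  with w(2) have "\<gamma> * norm (F y - F z) \<le> \<gamma> * ((L0 + L1 * (3 / 2 * N) powr \<alpha>) * norm (y - z))"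
    using \<gamma> by (intro mult_left_mono) auto
  also have "\<dots> \<le> 1 / 3 * norm (y - z)"
    using mult_right_mono [OF small' norm_ge_zero [of "y - z"]] by (simp add: mult.assoc)
  finally show ?thesis by simp
qed

text \<open>
  The extrapolated point has distance \<open>\<gamma> N\<close> from \<open>x\<close>, and then \<open>\<parallel>F xh\<parallel> \<le> 4 / 3 N\<close> keeps the next
  iterate in the ball of radius \<open>4 / 3 \<gamma> N\<close>, which explains the choice of this radius.
\<close>

lemma extragradient_local_contraction:
  fixes F :: "real ^ 'd \<Rightarrow> real ^ 'd" and x :: "real ^ 'd" and \<gamma> :: real
  defines "xh \<equiv> x - \<gamma> *\<^sub>R F x"
  assumes lip: "alpha_symmetric_Lipschitz \<alpha> L0 L1 F" and \<alpha>: "0 < \<alpha>" "\<alpha> < 1"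
    and N: "F x \<noteq> 0" and \<gamma>: "0 < \<gamma>"
    and small: "\<gamma> * (L0 + L1 * norm (F x) powr \<alpha>) \<le> 1 / 4"
    and small': "\<gamma> * (L0 + L1 * (3 / 2 * norm (F x)) powr \<alpha>) \<le> 1 / 3"
  shows "norm (F xh - F x) \<le> norm (F x) / 3"
    and "norm (F (x - \<gamma> *\<^sub>R F xh) - F xh) \<le> norm (F xh - F x) / 3"
proof -
  note near = alpha_symmetric_Lipschitz_near [OF lip \<alpha> _ \<gamma> small small']
  let ?B = "cball x (4 / 3 * \<gamma> * norm (F x))"
  have mem: "x \<in> ?B" "xh \<in> ?B" using \<gamma> by (auto simp: xh_def dist_norm)
  have "\<gamma> * norm (F xh - F x) \<le> norm (xh - x) / 3" using N mem by (intro near) auto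
  then show first: "norm (F xh - F x) \<le> norm (F x) / 3"
    using \<gamma> by (simp add: xh_def)
  have "norm (F xh) \<le> 4 / 3 * norm (F x)"
    using norm_triangle_ineq2 [of "F xh" "F x"] first by simp
  then have "x - \<gamma> *\<^sub>R F xh \<in> ?B" using \<gamma> by (simp add: dist_norm)
  then have "\<gamma> * norm (F (x - \<gamma> *\<^sub>R F xh) - F xh) \<le> norm (x - \<gamma> *\<^sub>R F xh - xh) / 3"
    using N mem by (intro near) auto
  also have "x - \<gamma> *\<^sub>R F xh - xh = \<gamma> *\<^sub>R (F x - F xh)" by (simp add: xh_def algebra_simps)
  finally show "norm (F (x - \<gamma> *\<^sub>R F xh) - F xh) \<le> norm (F xh - F x) / 3"
    using \<gamma> by (simp add: norm_minus_commute)
qed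

section \<open>Decay of the operator norm along the iterates\<close>

text \<open>
  One step with \<open>v = F x\<close>, \<open>w = F xh\<close>, \<open>v' = F x'\<close> and the discrepancy \<open>d = \<parallel>w - v\<parallel>\<close>. The first
  inequality is the classical descent of the distance, by monotonicity between \<open>xh\<close> and \<open>xs\<close>. The
  second views the step as an inexact implicit one: it retains the product \<open>\<langle>v', x' - xs\<rangle>\<close>, at the
  price of an error linear in \<open>d\<close>. The third says that this product falls by about \<open>\<gamma> \<parallel>v\<parallel>\<^sup>2\<close> per step
  unless the operator turns. The fourth, by monotonicity between \<open>x\<close> and \<open>x'\<close>, makes every turn
  cost some decrease of \<open>\<parallel>F\<parallel>\<close>.
\<close>

lemma extragradient_step_inequalities:
  fixes F :: "real ^ 'd \<Rightarrow> real ^ 'd" and x xs :: "real ^ 'd" and \<gamma> :: real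
  defines "xh \<equiv> x - \<gamma> *\<^sub>R F x"
  defines "x' \<equiv> x - \<gamma> *\<^sub>R F xh"
  defines "d \<equiv> norm (F xh - F x)"
  assumes mono: "monotone_operator F" and root: "F xs = 0" and \<gamma>: "0 < \<gamma>"
    and d: "d \<le> norm (F x) / 3" and d': "norm (F x' - F xh) \<le> d / 3"
  shows "(norm (x' - xs))\<^sup>2 \<le> (norm (x - xs))\<^sup>2 - 8 / 9 * (\<gamma>\<^sup>2 * (norm (F x))\<^sup>2)"
    and "(norm (x' - xs))\<^sup>2 \<le> (norm (x - xs))\<^sup>2 - 2 * \<gamma> * (F x' \<bullet> (x' - xs))
           + 2 / 3 * \<gamma> * d * norm (x' - xs) - 4 / 9 * (\<gamma>\<^sup>2 * (norm (F x))\<^sup>2)"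
    and "F x' \<bullet> (x' - xs) - F x \<bullet> (x - xs)
           \<le> 4 / 3 * d * norm (x' - xs) - \<gamma> * ((norm (F x))\<^sup>2 - norm (F x) * d)"
    and "(norm (F x'))\<^sup>2 \<le> (norm (F x))\<^sup>2 - 8 / 9 * d\<^sup>2"
proof -
  let ?v = "F x" and ?w = "F xh" and ?v' = "F x'"
  have d_nonneg: "0 \<le> d" by (simp add: d_def)
  have d_sq: "d\<^sup>2 \<le> (norm ?v)\<^sup>2 / 9"
    using power_mono [OF d d_nonneg, of 2] by (simp add: power_divide)
  have d'_sq: "(norm (?v' - ?w))\<^sup>2 \<le> d\<^sup>2 / 9"
    using power_mono [OF d' norm_ge_zero, of 2] by (simp add: power_divide)
  have sq_w: "d\<^sup>2 = (norm ?w)\<^sup>2 - 2 * (?w \<bullet> ?v) + (norm ?v)\<^sup>2"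
    unfolding d_def by (simp add: power2_norm_eq_inner algebra_simps inner_commute)
  have sq_v': "(norm (?v' - ?w))\<^sup>2 = (norm ?v')\<^sup>2 - 2 * (?w \<bullet> ?v') + (norm ?w)\<^sup>2"
    by (simp add: power2_norm_eq_inner algebra_simps inner_commute)
  have mono_xs: "0 \<le> F y \<bullet> (y - xs)" for y
    using mono root unfolding monotone_operator_def by (metis diff_zero)
  have dist': "(norm (x' - xs))\<^sup>2 = (norm (x - xs))\<^sup>2 - 2 * \<gamma> * (?w \<bullet> (x - xs)) + \<gamma>\<^sup>2 * (norm ?w)\<^sup>2"
  proof -
    have expand: "(norm (u - \<gamma> *\<^sub>R w))\<^sup>2 = (norm u)\<^sup>2 - 2 * \<gamma> * (w \<bullet> u) + \<gamma>\<^sup>2 * (norm w)\<^sup>2"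
      for u w :: "real ^ 'd"
      by (simp only: power2_norm_eq_inner)
        (simp add: inner_diff_left inner_diff_right inner_commute power2_eq_square algebra_simps)
    have "x' - xs = (x - xs) - \<gamma> *\<^sub>R ?w" by (simp add: x'_def)
    then show ?thesis by (simp only: expand)
  qed
  show "(norm (x' - xs))\<^sup>2 \<le> (norm (x - xs))\<^sup>2 - 8 / 9 * (\<gamma>\<^sup>2 * (norm (F x))\<^sup>2)"
  proof -
    have "?w \<bullet> (x - xs) = ?w \<bullet> (xh - xs) + \<gamma> * (?w \<bullet> ?v)"
      by (simp add: xh_def algebra_simps)
    then have "?w \<bullet> (x - xs) \<ge> \<gamma> * (?w \<bullet> ?v)" using mono_xs [of xh] by simp
    then have "2 * \<gamma> * (\<gamma> * (?w \<bullet> ?v)) \<le> 2 * \<gamma> * (?w \<bullet> (x - xs))"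
      using \<gamma> by (intro mult_left_mono) auto
    then have "(norm (x' - xs))\<^sup>2 \<le> (norm (x - xs))\<^sup>2 - \<gamma>\<^sup>2 * (2 * (?w \<bullet> ?v) - (norm ?w)\<^sup>2)"
      unfolding dist' by (simp add: power2_eq_square algebra_simps)
    also have "2 * (?w \<bullet> ?v) - (norm ?w)\<^sup>2 = (norm ?v)\<^sup>2 - d\<^sup>2" using sq_w by simp
    finally have "(norm (x' - xs))\<^sup>2 \<le> (norm (x - xs))\<^sup>2 - \<gamma>\<^sup>2 * ((norm ?v)\<^sup>2 - d\<^sup>2)" .
    moreover have "\<gamma>\<^sup>2 * (8 / 9 * (norm ?v)\<^sup>2) \<le> \<gamma>\<^sup>2 * ((norm ?v)\<^sup>2 - d\<^sup>2)"
      using d_sq by (intro mult_left_mono) auto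
    ultimately show ?thesis by simp
  qed
  show "(norm (x' - xs))\<^sup>2 \<le> (norm (x - xs))\<^sup>2 - 2 * \<gamma> * (F x' \<bullet> (x' - xs))
           + 2 / 3 * \<gamma> * d * norm (x' - xs) - 4 / 9 * (\<gamma>\<^sup>2 * (norm (F x))\<^sup>2)"
  proof -
    have "?w \<bullet> (x - xs) = ?w \<bullet> (x' - xs) + \<gamma> * (norm ?w)\<^sup>2"
      by (simp add: x'_def power2_norm_eq_inner algebra_simps)
    then have eq: "(norm (x' - xs))\<^sup>2 = (norm (x - xs))\<^sup>2 - 2 * \<gamma> * (?w \<bullet> (x' - xs)) - \<gamma>\<^sup>2 * (norm ?w)\<^sup>2"
      unfolding dist' by (simp add: power2_eq_square algebra_simps)
    have "(?v' - ?w) \<bullet> (x' - xs) \<le> norm (?v' - ?w) * norm (x' - xs)" by (rule norm_cauchy_schwarz)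
    also have "\<dots> \<le> d / 3 * norm (x' - xs)" using d' by (intro mult_right_mono) auto
    finally have "?w \<bullet> (x' - xs) \<ge> ?v' \<bullet> (x' - xs) - d / 3 * norm (x' - xs)"
      by (simp add: inner_diff_left)
    then have cross: "2 * \<gamma> * (?v' \<bullet> (x' - xs) - d / 3 * norm (x' - xs)) \<le> 2 * \<gamma> * (?w \<bullet> (x' - xs))"
      using \<gamma> by (intro mult_left_mono) auto
    have "norm ?w \<ge> norm ?v - d"
      unfolding d_def using norm_triangle_ineq2 [of ?v ?w] by (simp add: norm_minus_commute)
    then have "norm ?w \<ge> 2 / 3 * norm ?v" using d by simp
    from power_mono [OF this, of 2] have "4 / 9 * (norm ?v)\<^sup>2 \<le> (norm ?w)\<^sup>2"
      by (simp add: power_mult_distrib power2_eq_square)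
    then have "\<gamma>\<^sup>2 * (4 / 9 * (norm ?v)\<^sup>2) \<le> \<gamma>\<^sup>2 * (norm ?w)\<^sup>2"
      by (intro mult_left_mono) auto
    with cross show ?thesis unfolding eq by (simp add: algebra_simps)
  qed
  show "F x' \<bullet> (x' - xs) - F x \<bullet> (x - xs)
           \<le> 4 / 3 * d * norm (x' - xs) - \<gamma> * ((norm (F x))\<^sup>2 - norm (F x) * d)"
  proof -
    have "?v' \<bullet> (x' - xs) - ?v \<bullet> (x - xs) = (?v' - ?v) \<bullet> (x' - xs) - \<gamma> * (?w \<bullet> ?v)"
      by (simp add: x'_def algebra_simps inner_commute)
    moreover have "(?v' - ?v) \<bullet> (x' - xs) \<le> 4 / 3 * d * norm (x' - xs)"
    proof -
      have "norm (?v' - ?v) \<le> norm (?v' - ?w) + norm (?w - ?v)"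
        using norm_triangle_ineq [of "?v' - ?w" "?w - ?v"] by simp
      then have "norm (?v' - ?v) \<le> 4 / 3 * d" using d' by (simp add: d_def)
      then have "norm (?v' - ?v) * norm (x' - xs) \<le> 4 / 3 * d * norm (x' - xs)"
        by (intro mult_right_mono) auto
      then show ?thesis using norm_cauchy_schwarz [of "?v' - ?v" "x' - xs"] by linarith
    qed
    moreover have "(norm ?v)\<^sup>2 - norm ?v * d \<le> ?w \<bullet> ?v"
    proof -
      have "(?v - ?w) \<bullet> ?v \<le> norm (?v - ?w) * norm ?v" by (rule norm_cauchy_schwarz)
      then show ?thesis
        by (simp add: d_def norm_minus_commute inner_diff_left power2_norm_eq_inner mult.commute)
    qed
    then have "\<gamma> * ((norm ?v)\<^sup>2 - norm ?v * d) \<le> \<gamma> * (?w \<bullet> ?v)"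
      using \<gamma> by (intro mult_left_mono) auto
    ultimately show ?thesis by linarith
  qed
  show "(norm (F x'))\<^sup>2 \<le> (norm (F x))\<^sup>2 - 8 / 9 * d\<^sup>2"
  proof -
    have "0 \<le> (?v' - ?v) \<bullet> (x' - x)"
      using mono unfolding monotone_operator_def by blast
    also have "(?v' - ?v) \<bullet> (x' - x) = \<gamma> * (?w \<bullet> ?v - ?w \<bullet> ?v')"
      by (simp add: x'_def algebra_simps inner_commute)
    finally have "?w \<bullet> ?v' \<le> ?w \<bullet> ?v" using \<gamma> by (simp add: zero_le_mult_iff)
    then show ?thesis using sq_w sq_v' d'_sq by linarith
  qed
qed

text \<open>
  The potential \<open>V\<close> combines the squared distance, the product \<open>a = \<langle>F x, x - xs\<rangle>\<close> and \<open>\<parallel>F x\<parallel>\<^sup>2\<close>.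
  Without the middle term, the weight of \<open>\<parallel>F x\<parallel>\<^sup>2\<close> could grow by at most \<open>8 / 9\<close> per step. The
  product adds \<open>k / n\<close> to this, at the price of an error proportional to \<open>d r'\<close>, which is split
  between the last inequality of a step and a slow decrease of the weight of the squared distance.
  Balancing these gives a weight of \<open>7 / 6 n - 9 / 2\<close> after \<open>n\<close> steps; the negative term in
  \<open>s\<close> pays for the discretisation. The number \<open>g\<close> is a common lower bound of the step sizes.
\<close>

lemma potential_step_scalar:
  fixes r r' N N' d a a' \<gamma> g k n :: real
  defines "s \<equiv> \<lambda>j. 8 / 9 * j + 5 / 18 * (j\<^sup>2 / n) - 9 / 2 * (j / n)"
  defines "V \<equiv> \<lambda>j r a N. (1 - j / (2 * n)) * r\<^sup>2 + j / n * (g * a) + s j * (g\<^sup>2 * N\<^sup>2)"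
  assumes n: "48 \<le> n" and k: "0 \<le> k" "k + 1 \<le> n"
    and g: "0 < g" "g \<le> \<gamma>"
    and nonneg: "0 \<le> r'" "0 \<le> N" "0 \<le> d" "0 \<le> a'" and d: "d \<le> N / 3"
    and dist: "r'\<^sup>2 \<le> r\<^sup>2 - 8 / 9 * (\<gamma>\<^sup>2 * N\<^sup>2)"
    and dist': "r'\<^sup>2 \<le> r\<^sup>2 - 2 * \<gamma> * a' + 2 / 3 * \<gamma> * d * r' - 4 / 9 * (\<gamma>\<^sup>2 * N\<^sup>2)"
    and cross: "a' - a \<le> 4 / 3 * d * r' - \<gamma> * (N\<^sup>2 - N * d)"
    and decr: "N'\<^sup>2 \<le> N\<^sup>2 - 8 / 9 * d\<^sup>2"
  shows "V (k + 1) r' a' N' \<le> V k r a N"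
proof -
  define b where "b = 1 - k / (2 * n)"
  define H where "H = g * N"
  define D where "D = g * d"
  have npos: "n > 0" using n by simp
  have b: "1 / 2 \<le> b" "b \<le> 1" using k npos by (auto simp: b_def field_simps)
  have \<gamma>: "\<gamma> > 0" using g by simp
  have HD: "0 \<le> H" "0 \<le> D" using g nonneg by (auto simp: H_def D_def)
  \<comment> \<open>Average the two distance inequalities; the weight \<open>\<nu>\<close> of the second one is chosen so that its
    term in \<open>a'\<close> pays exactly for the growth of the weight of \<open>a\<close> from \<open>k / n\<close> to \<open>(k + 1) / n\<close>.\<close>
  define \<nu> where "\<nu> = g / (2 * n * b * \<gamma>)"
  have \<nu>b: "2 * \<nu> * b * \<gamma> = g / n" using b \<gamma> npos by (simp add: \<nu>_def)
  have \<nu>0: "0 \<le> \<nu>" using b \<gamma> g npos by (simp add: \<nu>_def)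
  have "2 * b * \<gamma> \<ge> 1 * g" using b g by (intro mult_mono) auto
  then have \<nu>1: "\<nu> \<le> 1 / n" using b \<gamma> npos by (simp add: \<nu>_def field_simps)
  have "1 / n \<le> 1" using n by simp
  with \<nu>1 have \<nu>_le1: "\<nu> \<le> 1" by linarith
  have "(1 - \<nu>) * r'\<^sup>2 + \<nu> * r'\<^sup>2 \<le> (1 - \<nu>) * (r\<^sup>2 - 8 / 9 * (\<gamma>\<^sup>2 * N\<^sup>2))
      + \<nu> * (r\<^sup>2 - 2 * \<gamma> * a' + 2 / 3 * \<gamma> * d * r' - 4 / 9 * (\<gamma>\<^sup>2 * N\<^sup>2))"
    using dist dist' \<nu>0 \<nu>_le1 by (intro add_mono mult_left_mono) auto
  then have "r'\<^sup>2 \<le> r\<^sup>2 - 2 * \<nu> * \<gamma> * a' + 2 / 3 * \<nu> * \<gamma> * d * r' - 8 / 9 * (1 - \<nu> / 2) * (\<gamma>\<^sup>2 * N\<^sup>2)"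
    by (simp add: algebra_simps diff_divide_distrib)
  then have "b * r'\<^sup>2 \<le> b * (r\<^sup>2 - 2 * \<nu> * \<gamma> * a' + 2 / 3 * \<nu> * \<gamma> * d * r' - 8 / 9 * (1 - \<nu> / 2) * (\<gamma>\<^sup>2 * N\<^sup>2))"
    using b by (intro mult_left_mono) auto
  also have "\<dots> = b * r\<^sup>2 - (2 * \<nu> * b * \<gamma>) * a' + (2 * \<nu> * b * \<gamma>) * d * r' / 3 - 8 / 9 * b * (1 - \<nu> / 2) * (\<gamma>\<^sup>2 * N\<^sup>2)"
    by (simp add: algebra_simps)
  also have "\<dots> = b * r\<^sup>2 - g * a' / n + D * r' / (3 * n) - 8 / 9 * b * (1 - \<nu> / 2) * (\<gamma>\<^sup>2 * N\<^sup>2)"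
    unfolding \<nu>b by (simp add: D_def)
  finally have "b * r'\<^sup>2 \<le> b * r\<^sup>2 - g * a' / n + D * r' / (3 * n) - 8 / 9 * b * (1 - \<nu> / 2) * (\<gamma>\<^sup>2 * N\<^sup>2)" .
  moreover have "8 / 9 * b * (1 - \<nu> / 2) * (\<gamma>\<^sup>2 * N\<^sup>2) \<ge> 8 / 9 * b * (1 - 1 / (2 * n)) * H\<^sup>2"
  proof (intro mult_mono)
    show "H\<^sup>2 \<le> \<gamma>\<^sup>2 * N\<^sup>2" unfolding H_def power_mult_distrib
      using g by (intro mult_right_mono power_mono) auto
    show "1 - 1 / (2 * n) \<le> 1 - \<nu> / 2" using \<nu>1 by simp
  qed (use b \<nu>_le1 n in auto)
  ultimately have dist_part: "b * r'\<^sup>2 \<le> b * r\<^sup>2 - g * a' / n + D * r' / (3 * n) - 8 / 9 * b * (1 - 1 / (2 * n)) * H\<^sup>2"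
    by linarith
  have "N * d \<le> N * N" using d nonneg by (intro mult_left_mono) auto
  then have "g * (N\<^sup>2 - N * d) \<le> \<gamma> * (N\<^sup>2 - N * d)"
    using g by (intro mult_right_mono) (auto simp: power2_eq_square)
  then have "a' - a \<le> 4 / 3 * d * r' - g * (N\<^sup>2 - N * d)" using cross by linarith
  then have "g * (a' - a) \<le> g * (4 / 3 * d * r' - g * (N\<^sup>2 - N * d))"
    using g by (intro mult_left_mono) auto
  also have "\<dots> = 4 / 3 * (D * r') - H\<^sup>2 + H * D"
    by (simp add: H_def D_def power2_eq_square algebra_simps)
  finally have "k / n * (g * (a' - a)) \<le> k / n * (4 / 3 * (D * r') - H\<^sup>2 + H * D)"
    using k npos by (intro mult_left_mono) auto
  then have cross_part: "(k + 1) / n * (g * a') - k / n * (g * a)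
      \<le> g * a' / n + 4 / 3 * (k / n) * (D * r') - k / n * H\<^sup>2 + k / n * (H * D)"
    by (simp add: algebra_simps add_divide_distrib)
  \<comment> \<open>The weight \<open>s\<close> exceeds \<open>j\<^sup>2 / n\<close> by a multiple of \<open>j\<close>: the first part absorbs the error
    \<open>D r'\<close>, the excess absorbs \<open>H D\<close>. The excess is
    positive up to \<open>j = n\<close> because \<open>n \<ge> 48\<close>.\<close>
  have s_lower: "8 / 9 * (s (k + 1) - (k + 1)\<^sup>2 / n) \<ge> k / 16"
  proof -
    have "1 / 16 \<le> 8 / 9 * (8 / 9 - 13 / 18 * u - 9 / 2 * v)" if "u \<le> 1" "v \<le> 1 / 48" for u v :: real
      using that by (simp add: field_simps)
    moreover have "(k + 1) / n \<le> 1" "1 / n \<le> 1 / 48" using k n npos by (auto simp: field_simps)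
    ultimately have "1 / 16 \<le> 8 / 9 * (8 / 9 - 13 / 18 * ((k + 1) / n) - 9 / 2 * (1 / n))" by blast
    then have scaled: "(k + 1) * (1 / 16) \<le> (k + 1) * (8 / 9 * (8 / 9 - 13 / 18 * ((k + 1) / n) - 9 / 2 * (1 / n)))"
      using k by (intro mult_left_mono) auto
    have "k / 16 \<le> (k + 1) * (1 / 16)" by simp
    also note scaled
    also have "(k + 1) * (8 / 9 * (8 / 9 - 13 / 18 * ((k + 1) / n) - 9 / 2 * (1 / n))) = 8 / 9 * (s (k + 1) - (k + 1)\<^sup>2 / n)"
      using npos by (simp add: s_def power2_eq_square field_simps)
    finally show ?thesis .
  qed
  have "0 \<le> (k + 1)\<^sup>2 / n" using npos by simp
  moreover have "0 \<le> s (k + 1)" if "0 \<le> z" "k / 16 \<le> 8 / 9 * (s (k + 1) - z)" for z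
    using that k by simp
  ultimately have s_nonneg: "0 \<le> s (k + 1)" using s_lower by blast
  have "g\<^sup>2 * N'\<^sup>2 \<le> g\<^sup>2 * (N\<^sup>2 - 8 / 9 * d\<^sup>2)" using decr by (intro mult_left_mono) auto
  also have "\<dots> = H\<^sup>2 - 8 / 9 * D\<^sup>2" by (simp add: H_def D_def power_mult_distrib algebra_simps)
  finally have op_part: "s (k + 1) * (g\<^sup>2 * N'\<^sup>2) \<le> s (k + 1) * (H\<^sup>2 - 8 / 9 * D\<^sup>2)"
    using s_nonneg by (intro mult_left_mono)
  \<comment> \<open>The error \<open>D r'\<close> is split between the decrease of the weight of the squared distance and
    the part \<open>j\<^sup>2 / n\<close> of \<open>s\<close>.\<close>
  have sq1: "4 / 3 * (k / n) * (D * r') + D * r' / (3 * n) \<le> r'\<^sup>2 / (2 * n) + 8 / 9 * ((k + 1)\<^sup>2 / n) * D\<^sup>2"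
  proof -
    have "0 \<le> (r' - 4 / 3 * (k + 1) * D)\<^sup>2 / (2 * n)" using npos by simp
    also have "\<dots> = r'\<^sup>2 / (2 * n) + 8 / 9 * ((k + 1)\<^sup>2 / n) * D\<^sup>2 - 4 / 3 * ((k + 1) / n) * (D * r')"
      using npos by (simp add: power2_eq_square field_simps)
    finally have "4 / 3 * ((k + 1) / n) * (D * r') \<le> r'\<^sup>2 / (2 * n) + 8 / 9 * ((k + 1)\<^sup>2 / n) * D\<^sup>2"
      by linarith
    moreover have "0 \<le> D * r' / n" using HD nonneg npos by simp
    ultimately show ?thesis by (simp add: algebra_simps add_divide_distrib)
  qed
  have sq2: "k / n * (H * D) \<le> 4 * k / n\<^sup>2 * H\<^sup>2 + k / 16 * D\<^sup>2"
  proof -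
    have "0 \<le> k * (2 * H / n - D / 4)\<^sup>2" using k by simp
    also have "\<dots> = 4 * k / n\<^sup>2 * H\<^sup>2 + k / 16 * D\<^sup>2 - k / n * (H * D)"
      using npos by (simp add: power2_eq_square field_simps)
    finally show ?thesis by linarith
  qed
  \<comment> \<open>What is left must be covered by the descent of the distance: this inequality dictates the
    coefficients of \<open>s\<close>.\<close>
  have budget: "s (k + 1) - s k - k / n + 4 * k / n\<^sup>2 \<le> 8 / 9 * b * (1 - 1 / (2 * n))"
  proof -
    have "8 / 9 * b * (1 - 1 / (2 * n)) - (s (k + 1) - s k - k / n + 4 * k / n\<^sup>2)
       = 34 / 9 * (n - k) / n\<^sup>2"
      using npos by (simp add: b_def s_def power2_eq_square field_simps)
    moreover have "0 \<le> 34 / 9 * (n - k) / n\<^sup>2" using k by simp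
    ultimately show ?thesis by linarith
  qed
  have budget': "(s (k + 1) - s k - k / n + 4 * k / n\<^sup>2) * H\<^sup>2 \<le> 8 / 9 * b * (1 - 1 / (2 * n)) * H\<^sup>2"
    using budget by (intro mult_right_mono) auto
  have s_lower': "k / 16 * D\<^sup>2 \<le> 8 / 9 * (s (k + 1) - (k + 1)\<^sup>2 / n) * D\<^sup>2"
    using s_lower by (intro mult_right_mono) auto
  have "V (k + 1) r' a' N' = b * r'\<^sup>2 - r'\<^sup>2 / (2 * n) + (k + 1) / n * (g * a') + s (k + 1) * (g\<^sup>2 * N'\<^sup>2)"
    by (simp add: V_def b_def algebra_simps add_divide_distrib)
  moreover have "V k r a N = b * r\<^sup>2 + k / n * (g * a) + s k * H\<^sup>2"
    by (simp add: V_def b_def H_def power_mult_distrib)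
  moreover have "s (k + 1) * (H\<^sup>2 - 8 / 9 * D\<^sup>2) = s (k + 1) * H\<^sup>2 - 8 / 9 * (s (k + 1) * D\<^sup>2)"
    by (simp add: algebra_simps)
  moreover have "8 / 9 * (s (k + 1) - (k + 1)\<^sup>2 / n) * D\<^sup>2 = 8 / 9 * (s (k + 1) * D\<^sup>2) - 8 / 9 * ((k + 1)\<^sup>2 / n) * D\<^sup>2"
    by (simp add: algebra_simps)
  moreover have "(s (k + 1) - s k - k / n + 4 * k / n\<^sup>2) * H\<^sup>2
      = s (k + 1) * H\<^sup>2 - s k * H\<^sup>2 - k / n * H\<^sup>2 + 4 * k / n\<^sup>2 * H\<^sup>2"
    by (simp add: algebra_simps)
  ultimately show ?thesis
    using dist_part cross_part op_part sq1 sq2 budget' s_lower' by linarith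
qed

text \<open>
  The potential starts at \<open>\<parallel>x 0 - xs\<parallel>\<^sup>2\<close>, and at the end half of the squared distance remains in it.
  The hypothesis on the last iterate turns this half into \<open>8\<close> further units of
  \<open>g\<^sup>2 \<parallel>F\<parallel>\<^sup>2\<close>, and \<open>8 + (7 / 6 n - 9 / 2) \<ge> 9 / 8 (n + 1)\<close>. For fewer than \<open>48\<close> steps, which the potential
  does not cover, the whole squared distance is worth \<open>16\<close> units and the classical descent is
  enough.
\<close>

lemma extragradient_last_iterate_rate:
  fixes F :: "real ^ 'd \<Rightarrow> real ^ 'd" and x :: "nat \<Rightarrow> real ^ 'd" and \<gamma> :: "nat \<Rightarrow> real"
  assumes mono: "monotone_operator F" and root: "F xs = 0" and eg: "extragradient F \<gamma> \<gamma> x"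
    and g: "0 < g" "\<And>k. k < n \<Longrightarrow> g \<le> \<gamma> k"
    and d: "\<And>k. k < n \<Longrightarrow> norm (F (x k - \<gamma> k *\<^sub>R F (x k)) - F (x k)) \<le> norm (F (x k)) / 3"
    and d': "\<And>k. k < n \<Longrightarrow> norm (F (x (Suc k)) - F (x k - \<gamma> k *\<^sub>R F (x k)))
               \<le> norm (F (x k - \<gamma> k *\<^sub>R F (x k)) - F (x k)) / 3"
    and last: "4 * g * norm (F (x n)) \<le> norm (x n - xs)"
  shows "9 / 8 * (real n + 1) * (g\<^sup>2 * (norm (F (x n)))\<^sup>2) \<le> (norm (x 0 - xs))\<^sup>2"
proof -
  define N where "N = (\<lambda>k. norm (F (x k)))"
  define r where "r = (\<lambda>k. norm (x k - xs))"
  define a where "a = (\<lambda>k. F (x k) \<bullet> (x k - xs))"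
  define \<Delta> where "\<Delta> = (\<lambda>k. norm (F (x k - \<gamma> k *\<^sub>R F (x k)) - F (x k)))"
  have x_Suc: "x (Suc k) = x k - \<gamma> k *\<^sub>R F (x k - \<gamma> k *\<^sub>R F (x k))" for k
    using eg by (simp add: extragradient_def Let_def)
  have a_nonneg: "0 \<le> a k" for k
    using mono root unfolding monotone_operator_def a_def by (metis diff_zero)
  have step:
    "(r (Suc k))\<^sup>2 \<le> (r k)\<^sup>2 - 8 / 9 * ((\<gamma> k)\<^sup>2 * (N k)\<^sup>2)"
    "(r (Suc k))\<^sup>2 \<le> (r k)\<^sup>2 - 2 * \<gamma> k * a (Suc k) + 2 / 3 * \<gamma> k * \<Delta> k * r (Suc k) - 4 / 9 * ((\<gamma> k)\<^sup>2 * (N k)\<^sup>2)"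
    "a (Suc k) - a k \<le> 4 / 3 * \<Delta> k * r (Suc k) - \<gamma> k * ((N k)\<^sup>2 - N k * \<Delta> k)"
    "(N (Suc k))\<^sup>2 \<le> (N k)\<^sup>2 - 8 / 9 * (\<Delta> k)\<^sup>2"
    if "k < n" for k
    using extragradient_step_inequalities [OF mono root, of "\<gamma> k" "x k"] g(2) [OF that] g(1)
      d [OF that] d' [OF that]
    unfolding r_def N_def a_def \<Delta>_def x_Suc by auto
  have last': "16 * (g\<^sup>2 * (N n)\<^sup>2) \<le> (r n)\<^sup>2"
    using power_mono [OF last, of 2] g by (simp add: N_def r_def power_mult_distrib)
  have H_nonneg: "0 \<le> g\<^sup>2 * (N n)\<^sup>2" by simp
  show ?thesis
  proof (cases "n < 48")
    case True
    have "(r k)\<^sup>2 \<le> (r 0)\<^sup>2 - 8 / 9 * real k * (g\<^sup>2 * (N k)\<^sup>2)" if "k \<le> n" for k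
      using that
    proof (induction k)
      case (Suc k)
      then have k: "k < n" by simp
      have "g\<^sup>2 \<le> (\<gamma> k)\<^sup>2" using g(1) g(2) [OF k] by (intro power_mono) auto
      then have "8 / 9 * (g\<^sup>2 * (N k)\<^sup>2) \<le> 8 / 9 * ((\<gamma> k)\<^sup>2 * (N k)\<^sup>2)"
        by (intro mult_left_mono mult_right_mono) auto
      with step(1) [OF k] Suc have "(r (Suc k))\<^sup>2 \<le> (r 0)\<^sup>2 - 8 / 9 * real (Suc k) * (g\<^sup>2 * (N k)\<^sup>2)"
        by (simp add: algebra_simps add_divide_distrib)
      moreover have "0 \<le> 8 / 9 * (\<Delta> k)\<^sup>2" by simp
      then have "(N (Suc k))\<^sup>2 \<le> (N k)\<^sup>2" using step(4) [OF k] by linarith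
      then have "8 / 9 * real (Suc k) * (g\<^sup>2 * (N (Suc k))\<^sup>2) \<le> 8 / 9 * real (Suc k) * (g\<^sup>2 * (N k)\<^sup>2)"
        by (intro mult_left_mono) auto
      ultimately show ?case by linarith
    qed simp
    from this [of n] last' have "(16 + 8 / 9 * real n) * (g\<^sup>2 * (N n)\<^sup>2) \<le> (r 0)\<^sup>2"
      by (simp add: algebra_simps)
    moreover have "9 / 8 * (real n + 1) * (g\<^sup>2 * (N n)\<^sup>2) \<le> (16 + 8 / 9 * real n) * (g\<^sup>2 * (N n)\<^sup>2)"
      using True by (intro mult_right_mono) auto
    ultimately show ?thesis by (simp add: N_def r_def)
  next
    case False
    define m where "m = real n"
    have m: "48 \<le> m" using False by (simp add: m_def)
    define s where "s = (\<lambda>j. 8 / 9 * j + 5 / 18 * (j\<^sup>2 / m) - 9 / 2 * (j / m))"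
    define V where "V = (\<lambda>k. (1 - real k / (2 * m)) * (r k)\<^sup>2 + real k / m * (g * a k) + s (real k) * (g\<^sup>2 * (N k)\<^sup>2))"
    have "V k \<le> (r 0)\<^sup>2" if "k \<le> n" for k
      using that
    proof (induction k)
      case 0
      then show ?case by (simp add: V_def s_def)
    next
      case (Suc k)
      then have k: "k < n" by simp
      have "V (Suc k) \<le> V k"
        unfolding V_def s_def of_nat_Suc add.commute [of 1]
        using m k g(1) g(2) [OF k] a_nonneg [of "Suc k"] d [OF k] step [OF k]
        by (intro potential_step_scalar [where d = "\<Delta> k" and \<gamma> = "\<gamma> k"])
          (auto simp: m_def r_def N_def \<Delta>_def)
      with Suc k show ?case by simp
    qed
    from this [of n] have "V n \<le> (r 0)\<^sup>2" by simp
    moreover have "V n = (r n)\<^sup>2 / 2 + g * a n + (7 / 6 * m - 9 / 2) * (g\<^sup>2 * (N n)\<^sup>2)"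
      using m by (simp add: V_def s_def m_def [symmetric] power2_eq_square field_simps)
    moreover have "0 \<le> g * a n" using g a_nonneg by simp
    ultimately have "(8 + 7 / 6 * m - 9 / 2) * (g\<^sup>2 * (N n)\<^sup>2) \<le> (r 0)\<^sup>2"
      using last' by (simp add: algebra_simps)
    moreover have "9 / 8 * (m + 1) * (g\<^sup>2 * (N n)\<^sup>2) \<le> (8 + 7 / 6 * m - 9 / 2) * (g\<^sup>2 * (N n)\<^sup>2)"
      using m by (intro mult_right_mono) auto
    ultimately show ?thesis by (simp add: N_def r_def m_def)
  qed
qed

section \<open>The step-size constants\<close>

lemma two_powr_three_halves: "(2::real) powr (3 / 2) = 2 * sqrt 2"
proof -
  have "(2::real) powr (3 / 2) = 2 powr (1 + 1 / 2)" by simp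
  also have "\<dots> = 2 * sqrt 2" unfolding powr_add by (simp add: powr_half_sqrt)
  finally show ?thesis .
qed

text \<open>
  Written as multiples of \<open>L1\<close>, the coefficient \<open>C\<close> of \<open>\<parallel>F x\<parallel>\<^sup>\<alpha>\<close> in \<open>1 / \<gamma>\<close> is \<open>2 sqrt 2 (q + y)\<close>, while
  the bracket of the error bound contains \<open>q + 2\<^sup>-\<^sup>3\<^sup>/\<^sup>2 t\<close>; here \<open>y = 2\<^sup>-\<^sup>3\<^sup>\<alpha>\<^sup>/\<^sup>2 t\<close> is larger than the
  second summand. The lower bounds make the steps short enough for contraction on the scale of a
  single step. The upper bound says that the mismatch costs at most a factor \<open>3 / 2\<close>, because
  \<open>y \<le> (3 / (2 sqrt 2)) q\<close>.
\<close>

lemma stepsize_coefficient_bounds: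
  fixes \<alpha> L1 :: real
  defines "C \<equiv> 2 * sqrt 2 * K1_const \<alpha> L1 + 2 powr (3 * (1 - \<alpha>) / 2) * K2_const \<alpha> L1 powr (1 - \<alpha>)"
  assumes \<alpha>: "0 < \<alpha>" "\<alpha> < 1" and L1: "0 \<le> L1"
  shows "4 * L1 \<le> C" and "3 * (3 / 2) powr \<alpha> * L1 \<le> C"
    and "C \<le> 3 * sqrt 2 * (K1_const \<alpha> L1 + 2 powr (- (3 / 2)) * K2_const \<alpha> L1 powr (1 - \<alpha>))"
proof -
  define q where "q = (2::real) powr (\<alpha>\<^sup>2 / (1 - \<alpha>))"
  define t where "t = 2 powr \<alpha>\<^sup>2 * 3 powr (\<alpha> * (1 - \<alpha>)) * (1 - \<alpha>) powr \<alpha>"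
  define y where "y = 2 powr (- (3 * \<alpha> / 2)) * t"
  have sqrt2: "1414 / 1000 \<le> sqrt 2" "sqrt 2 \<le> 1415 / 1000" "sqrt 2 * sqrt 2 = 2"
    by (rule real_le_rsqrt real_le_lsqrt; simp add: power2_eq_square)+ simp
  have q1: "1 \<le> q" using \<alpha> unfolding q_def by (intro ge_one_powr_ge_zero) auto
  have t0: "0 \<le> t" and y0: "0 \<le> y" by (auto simp: t_def y_def)
  have K1: "K1_const \<alpha> L1 = L1 * q" by (simp add: K1_const_def q_def)
  have K2: "K2_const \<alpha> L1 powr (1 - \<alpha>) = L1 * t"
    using \<alpha> L1 by (simp add: K2_const_def t_def powr_mult powr_powr)
  have "2 powr (3 * (1 - \<alpha>) / 2) = (2::real) powr (3 / 2 + - (3 * \<alpha> / 2))" by (simp add: field_simps)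
  also have "\<dots> = 2 * sqrt 2 * 2 powr (- (3 * \<alpha> / 2))"
    unfolding powr_add two_powr_three_halves ..
  finally have C: "C = L1 * (2 * sqrt 2 * (q + y))"
    unfolding C_def K1 K2 y_def by (simp add: algebra_simps)
  \<comment> \<open>For small \<open>\<alpha>\<close> both summands contribute, \<open>q \<ge> 1\<close> and \<open>y \<ge> 1 / 2\<close>. As \<open>\<alpha>\<close> tends to \<open>1\<close>, \<open>y\<close>
    tends to \<open>0\<close>, but then \<open>q \<ge> 2\<^sup>\<alpha>\<close> suffices.\<close>
  have lower: "sqrt 2 \<le> q + y \<and> 3 * (3 / 2) powr \<alpha> \<le> 2 * sqrt 2 * (q + y)"
  proof (cases "\<alpha> \<le> 1 / 2")
    case True
    have "0 \<le> (\<alpha> - 1 / 2) * (\<alpha> - 1)" using True \<alpha> by (intro mult_nonpos_nonpos) auto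
    then have e: "- (1 / 2) \<le> - (3 * \<alpha> / 2) + \<alpha>\<^sup>2" by (simp add: power2_eq_square field_simps)
    have "(1 / 2 :: real) * 1 = 2 powr (- (1 / 2)) * (1 * (1 / 2) powr (1 / 2))"
      by (simp add: powr_minus powr_divide field_simps powr_half_sqrt)
    also have "\<dots> \<le> 2 powr (- (3 * \<alpha> / 2) + \<alpha>\<^sup>2) * (3 powr (\<alpha> * (1 - \<alpha>)) * (1 - \<alpha>) powr \<alpha>)"
    proof (intro mult_mono)
      have "(1 / 2 :: real) powr (1 / 2) \<le> (1 / 2) powr \<alpha>" using True by (intro powr_mono') auto
      also have "\<dots> \<le> (1 - \<alpha>) powr \<alpha>" using True \<alpha> by (intro powr_mono2) auto
      finally show "(1 / 2 :: real) powr (1 / 2) \<le> (1 - \<alpha>) powr \<alpha>" .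
    qed (use e \<alpha> in \<open>auto intro: ge_one_powr_ge_zero\<close>)
    also have "\<dots> = y" by (simp only: y_def t_def powr_add mult.assoc)
    finally have qy: "3 / 2 \<le> q + y" using q1 by simp
    have "(3 / 2 :: real) powr \<alpha> \<le> (3 / 2) powr (1 / 2)" using True by (intro powr_mono) auto
    also have "\<dots> = sqrt (3 / 2)" by (simp add: powr_half_sqrt)
    also have "\<dots> \<le> 5 / 4" by (rule real_le_lsqrt) (auto simp: power2_eq_square)
    finally have "3 * (3 / 2) powr \<alpha> \<le> 2 * (1414 / 1000) * (3 / 2 :: real)" by simp
    also have "\<dots> \<le> 2 * sqrt 2 * (q + y)" using sqrt2 qy by (intro mult_mono) auto
    finally show ?thesis using qy sqrt2 by simp
  next
    case False
    have "\<alpha> * (1 - \<alpha>) \<le> \<alpha> * \<alpha>" using False \<alpha> by (intro mult_left_mono) auto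
    then have "\<alpha> \<le> \<alpha>\<^sup>2 / (1 - \<alpha>)" using \<alpha> by (simp add: field_simps power2_eq_square)
    then have q2: "2 powr \<alpha> \<le> q" unfolding q_def by (intro powr_mono) auto
    have "sqrt 2 = 2 powr (1 / 2)" by (simp add: powr_half_sqrt)
    also have "\<dots> \<le> 2 powr \<alpha>" using False by (intro powr_mono) auto
    finally have first: "sqrt 2 \<le> q + y" using q2 y0 by simp
    have "(115 / 100 :: real) \<le> sqrt (4 / 3)" by (rule real_le_rsqrt) (simp add: power2_eq_square)
    also have "\<dots> = (4 / 3) powr (1 / 2)" by (simp add: powr_half_sqrt)
    also have "\<dots> \<le> (4 / 3) powr \<alpha>" using False by (intro powr_mono) auto
    finally have "3 \<le> 2 * (1414 / 1000) * (4 / 3 :: real) powr \<alpha>" by simp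
    also have "\<dots> \<le> 2 * sqrt 2 * (4 / 3) powr \<alpha>" using sqrt2 by (intro mult_right_mono) auto
    finally have "3 * (3 / 2) powr \<alpha> \<le> 2 * sqrt 2 * (4 / 3) powr \<alpha> * (3 / 2) powr \<alpha>"
      by (intro mult_right_mono) auto
    also have "\<dots> = 2 * sqrt 2 * ((4 / 3 * (3 / 2)) powr \<alpha>)" by (simp only: powr_mult mult.assoc)
    also have "\<dots> \<le> 2 * sqrt 2 * (q + y)" using q2 y0 by (intro mult_left_mono) auto
    finally show ?thesis using first by simp
  qed
  have "4 = 2 * sqrt 2 * sqrt 2" using sqrt2(3) by linarith
  also have "\<dots> \<le> 2 * sqrt 2 * (q + y)" using lower by (intro mult_left_mono) auto
  finally have "4 \<le> 2 * sqrt 2 * (q + y)" .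
  then show "4 * L1 \<le> C" unfolding C using L1 mult_left_mono by fastforce
  show "3 * (3 / 2) powr \<alpha> * L1 \<le> C"
    unfolding C using mult_left_mono [OF conjunct2 [OF lower] L1] by (simp add: mult.commute)
  have "y = 2 powr (- (3 * \<alpha> / 2)) * 3 powr (\<alpha> * (1 - \<alpha>)) * (2 powr \<alpha>\<^sup>2 * (1 - \<alpha>) powr \<alpha>)"
    by (simp add: y_def t_def)
  also have "\<dots> \<le> 2 powr (- (3 * \<alpha> / 2)) * 3 powr \<alpha> * (q * 1)"
  proof (intro mult_mono)
    have "\<alpha> * (1 - \<alpha>) \<le> \<alpha> * 1" using \<alpha> by (intro mult_left_mono) auto
    then show "(3::real) powr (\<alpha> * (1 - \<alpha>)) \<le> 3 powr \<alpha>" by (intro powr_mono) auto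
    have "\<alpha>\<^sup>2 * (1 - \<alpha>) \<le> \<alpha>\<^sup>2 * 1" using \<alpha> by (intro mult_left_mono) auto
    then have "\<alpha>\<^sup>2 \<le> \<alpha>\<^sup>2 / (1 - \<alpha>)" using \<alpha> by (simp add: field_simps)
    then show "2 powr \<alpha>\<^sup>2 \<le> q" unfolding q_def by (intro powr_mono) auto
    show "(1 - \<alpha>) powr \<alpha> \<le> 1" using \<alpha> by (intro powr_le1) auto
  qed (use q1 in auto)
  also have "2 powr (- (3 * \<alpha> / 2)) * 3 powr \<alpha> = (3 / (2 * sqrt 2)) powr \<alpha>"
  proof -
    have "2 powr (3 * \<alpha> / 2) = (2 * sqrt 2) powr \<alpha>"
      unfolding two_powr_three_halves [symmetric] powr_powr by simp
    then show ?thesis by (simp add: powr_minus powr_divide field_simps)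
  qed
  also have "(3 / (2 * sqrt 2)) powr \<alpha> * (q * 1) \<le> 3 / (2 * sqrt 2) * (q * 1)"
  proof (intro mult_right_mono)
    have "1 \<le> 3 / (2 * sqrt 2)" using sqrt2 by (simp add: field_simps)
    then have "(3 / (2 * sqrt 2)) powr \<alpha> \<le> (3 / (2 * sqrt 2)) powr 1" using \<alpha> by (intro powr_mono) auto
    then show "(3 / (2 * sqrt 2)) powr \<alpha> \<le> 3 / (2 * sqrt 2)" by simp
  qed (use q1 in auto)
  also have "3 / (2 * sqrt 2) = 3 * sqrt 2 / 4" using sqrt2 by (simp add: field_simps)
  finally have yq: "y \<le> 3 * sqrt 2 / 4 * q" by simp
  have "(2::real) powr (- (3 * \<alpha> / 2)) \<le> 2 powr 0" using \<alpha> by (intro powr_mono) auto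
  then have "y \<le> 1 * t" unfolding y_def using t0 by (intro mult_right_mono) auto
  then have yt: "y \<le> t" by simp
  have "(2 * sqrt 2 - 3 / 2) * y \<le> (2 * sqrt 2 - 3 / 2) * (3 * sqrt 2 / 4 * q)"
    using sqrt2 yq by (intro mult_left_mono) auto
  also have "\<dots> = (3 - 9 / 8 * sqrt 2) * q"
    using sqrt2(3) by (simp add: algebra_simps)
  also have "\<dots> \<le> sqrt 2 * q" using sqrt2 q1 by (intro mult_right_mono) auto
  finally have "2 * sqrt 2 * (q + y) \<le> 3 * sqrt 2 * q + 3 / 2 * t" using yt by (simp add: algebra_simps)
  also have "\<dots> = 3 * sqrt 2 * (q + 2 powr (- (3 / 2)) * t)"
    using sqrt2 by (simp add: powr_minus two_powr_three_halves field_simps)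
  finally have "C \<le> L1 * (3 * sqrt 2 * (q + 2 powr (- (3 / 2)) * t))"
    unfolding C using L1 by (intro mult_left_mono)
  then show "C \<le> 3 * sqrt 2 * (K1_const \<alpha> L1 + 2 powr (- (3 / 2)) * K2_const \<alpha> L1 powr (1 - \<alpha>))"
    unfolding K1 K2 by (simp add: algebra_simps)
qed

section \<open>The convergence rate\<close>

theorem theorem4p6:
  fixes F :: "real ^ 'd \<Rightarrow> real ^ 'd"
    and x :: "nat \<Rightarrow> real ^ 'd"
    and xs :: "real ^ 'd"
    and \<gamma> \<omega> :: "nat \<Rightarrow> real"
    and \<alpha> L0 L1 K0 K1 K2 :: real
    and K :: nat
  assumes "0 < \<alpha>" and "\<alpha> < 1"
    and "monotone_operator F"
    and "alpha_symmetric_Lipschitz \<alpha> L0 L1 F"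
    and "F xs = 0"
    and "K0 = K0_const \<alpha> L0" and "K1 = K1_const \<alpha> L1" and "K2 = K2_const \<alpha> L1"
    and "extragradient F \<gamma> \<omega> x"
    and "\<And>k. \<gamma> k = 1 / (2 * sqrt 2 * K0 +
           (2 * sqrt 2 * K1 + 2 powr (3 * (1 - \<alpha>) / 2) * K2 powr (1 - \<alpha>)) * norm (F (x k)) powr \<alpha>)"
    and "\<And>k. \<omega> k = \<gamma> k"
  shows "Min ((\<lambda>k. (norm (F (x k)))\<^sup>2) ` {0..K}) \<le>
    16 * (K0 + (K1 + 2 powr (- (3 / 2)) * K2 powr (1 - \<alpha>)) *
            (K0 + K2 * norm (x 0 - xs) powr (\<alpha> / (1 - \<alpha>))) powr \<alpha> * norm (x 0 - xs) powr \<alpha>)\<^sup>2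
       * (norm (x 0 - xs))\<^sup>2 / (real K + 1)"
    (is "?min \<le> ?bound")
proof (cases "\<exists>k\<le>K. F (x k) = 0")
  case True
  then obtain k where "k \<le> K" "F (x k) = 0" by blast
  then have "?min \<le> (norm (F (x k)))\<^sup>2" by (intro Min_le) auto
  also have "\<dots> = 0" using \<open>F (x k) = 0\<close> by simp
  also have "0 \<le> ?bound" by simp
  finally show ?thesis .
next
  case False
  note \<alpha> = assms(1,2) and mono = assms(3) and lip = assms(4) and root = assms(5)
  note K_def = assms(6,7,8)
  have L: "0 \<le> L0" "0 \<le> L1" using lip by (auto simp: alpha_symmetric_Lipschitz_def)
  have "\<omega> = \<gamma>" using assms(11) by blast
  with assms(9) have eg: "extragradient F \<gamma> \<gamma> x" by simp
  have x_Suc: "x (Suc k) = x k - \<gamma> k *\<^sub>R F (x k - \<gamma> k *\<^sub>R F (x k))" for k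
    using eg by (simp add: extragradient_def Let_def)
  define R where "R = norm (x 0 - xs)"
  define C where "C = 2 * sqrt 2 * K1 + 2 powr (3 * (1 - \<alpha>) / 2) * K2 powr (1 - \<alpha>)"
  have C: "4 * L1 \<le> C" "3 * (3 / 2) powr \<alpha> * L1 \<le> C"
    "C \<le> 3 * sqrt 2 * (K1 + 2 powr (- (3 / 2)) * K2 powr (1 - \<alpha>))"
    unfolding C_def K_def by (rule stepsize_coefficient_bounds [OF \<alpha> L(2)])+
  have sqrt2: "1 \<le> sqrt 2" by simp
  have K_nonneg: "0 \<le> K1" "0 \<le> K2" "0 \<le> C"
    using L \<alpha> C by (auto simp: K_def K1_const_def K2_const_def)
  have "L0 * 2 \<le> K0"
    unfolding K_def K0_const_def using L \<alpha>
    by (intro mult_left_mono) (auto intro: ge_one_powr_ge_zero)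
  moreover have "1 * K0 \<le> sqrt 2 * K0"
    using L sqrt2 unfolding K_def K0_const_def by (intro mult_right_mono) auto
  ultimately have K0: "4 * L0 \<le> 2 * sqrt 2 * K0" "0 \<le> K0" using L by linarith+
  \<comment> \<open>With \<open>L0 = L1 = 0\<close> all step sizes would be \<open>1 / 0 = 0\<close>; but then \<open>F\<close> is constantly \<open>F xs = 0\<close>.\<close>
  have L_pos: "0 < L0 \<or> 0 < L1"
  proof (rule ccontr)
    assume "\<not> (0 < L0 \<or> 0 < L1)"
    then have "norm (F (x 0) - F xs) \<le> 0"
      using L alpha_symmetric_Lipschitz_segment [OF lip \<alpha>(1), of "x 0" xs] by auto
    then show False using False root by auto
  qed
  have den_pos: "0 < 2 * sqrt 2 * K0 + C * X" if "0 < X" for X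
  proof (cases "0 < L0")
    case True
    then show ?thesis using K0 K_nonneg that by (intro add_pos_nonneg) auto
  next
    case False
    then have "0 < C" using L_pos C(1) by auto
    then show ?thesis using K0 that by (intro add_nonneg_pos) auto
  qed
  have \<gamma>: "\<gamma> k = 1 / (2 * sqrt 2 * K0 + C * norm (F (x k)) powr \<alpha>)" for k
    using assms(10) by (simp add: C_def)
  have small: "L0 + L1 * X \<le> (2 * sqrt 2 * K0 + C * X) / 4" if "0 \<le> X" for X
    using K0(1) mult_right_mono [OF C(1) that] by (simp only: field_simps) simp
  have small': "L0 + L1 * (3 / 2 * N) powr \<alpha> \<le> (2 * sqrt 2 * K0 + C * N powr \<alpha>) / 3" if "0 \<le> N" for N
    using K0(1) L mult_right_mono [OF C(2), of "N powr \<alpha>"] that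
    by (simp only: powr_mult) (simp add: algebra_simps)
  have step:
    "0 < \<gamma> k"
    "norm (F (x k - \<gamma> k *\<^sub>R F (x k)) - F (x k)) \<le> norm (F (x k)) / 3"
    "norm (F (x (Suc k)) - F (x k - \<gamma> k *\<^sub>R F (x k))) \<le> norm (F (x k - \<gamma> k *\<^sub>R F (x k)) - F (x k)) / 3"
    if "k \<le> K" for k
  proof -
    have Fk: "F (x k) \<noteq> 0" using False that by blast
    have den: "0 < 2 * sqrt 2 * K0 + C * norm (F (x k)) powr \<alpha>" using Fk by (intro den_pos) auto
    then show pos: "0 < \<gamma> k" by (simp add: \<gamma>)
    have "\<gamma> k * (L0 + L1 * norm (F (x k)) powr \<alpha>) \<le> 1 / 4"
      "\<gamma> k * (L0 + L1 * (3 / 2 * norm (F (x k))) powr \<alpha>) \<le> 1 / 3"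
      using small [of "norm (F (x k)) powr \<alpha>"] small' [of "norm (F (x k))"] den
      by (simp_all add: \<gamma> pos_divide_le_eq)
    from extragradient_local_contraction [OF lip \<alpha> Fk pos this]
    show "norm (F (x k - \<gamma> k *\<^sub>R F (x k)) - F (x k)) \<le> norm (F (x k)) / 3"
      "norm (F (x (Suc k)) - F (x k - \<gamma> k *\<^sub>R F (x k))) \<le> norm (F (x k - \<gamma> k *\<^sub>R F (x k)) - F (x k)) / 3"
      unfolding x_Suc by auto
  qed
  have dist_le: "norm (x k - xs) \<le> R" if "k \<le> K" for k
    using that
  proof (induction k)
    case (Suc k)
    then have k: "k \<le> K" by simp
    have "(norm (x (Suc k) - xs))\<^sup>2 \<le> (norm (x k - xs))\<^sup>2 - 8 / 9 * ((\<gamma> k)\<^sup>2 * (norm (F (x k)))\<^sup>2)"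
      using extragradient_step_inequalities(1) [OF mono root step(1) [OF k] step(2) [OF k]]
        step(3) [OF k] unfolding x_Suc by blast
    also have "\<dots> \<le> (norm (x k - xs))\<^sup>2" by simp
    finally have "norm (x (Suc k) - xs) \<le> norm (x k - xs)" by (rule power2_le_imp_le) simp
    with Suc k show ?case by simp
  qed (simp add: R_def)
  \<comment> \<open>\<open>X\<close> bounds \<open>\<parallel>F\<parallel>\<^sup>\<alpha>\<close> on the ball around \<open>xs\<close> that contains all iterates, and \<open>g\<close> is the
    step size for this bound.\<close>
  define X where "X = (K0 + K2 * R powr (\<alpha> / (1 - \<alpha>))) powr \<alpha> * R powr \<alpha>"
  have F_le: "norm (F y) powr \<alpha> \<le> X" if "norm (y - xs) \<le> R" for y
  proof -
    have "norm (F y) \<le> (K0 + K2 * norm (y - xs) powr (\<alpha> / (1 - \<alpha>))) * norm (y - xs)"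
      using alpha_symmetric_Lipschitz_explicit [OF lip \<alpha>, of y xs] root \<alpha> by (simp add: K_def)
    also have "\<dots> \<le> (K0 + K2 * R powr (\<alpha> / (1 - \<alpha>))) * R"
      using that K0 K_nonneg \<alpha> by (intro mult_mono add_left_mono mult_left_mono powr_mono2) auto
    finally have "norm (F y) powr \<alpha> \<le> ((K0 + K2 * R powr (\<alpha> / (1 - \<alpha>))) * R) powr \<alpha>"
      using \<alpha> by (intro powr_mono2) auto
    then show ?thesis by (simp add: X_def powr_mult)
  qed
  have "0 < norm (F (x 0)) powr \<alpha>" using False by auto
  also have "\<dots> \<le> X" by (rule F_le) (simp add: R_def)
  finally have X: "0 < X" .
  define g where "g = 1 / (2 * sqrt 2 * K0 + C * X)"
  have g: "0 < g" using den_pos [OF X] by (simp add: g_def)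
  have g_le: "g \<le> \<gamma> k" if "k \<le> K" for k
  proof -
    have "0 < norm (F (x k)) powr \<alpha>" using False that by auto
    then have "0 < 2 * sqrt 2 * K0 + C * norm (F (x k)) powr \<alpha>" by (rule den_pos)
    moreover have "C * norm (F (x k)) powr \<alpha> \<le> C * X"
      using F_le dist_le that K_nonneg by (intro mult_left_mono) auto
    ultimately show ?thesis unfolding g_def \<gamma> by (intro divide_left_mono mult_pos_pos) auto
  qed
  \<comment> \<open>The segment from the last iterate to \<open>xs\<close> lies in the ball, where \<open>g F\<close> is
    \<open>1 / 4\<close>-Lipschitz.\<close>
  have last: "4 * g * norm (F (x K)) \<le> norm (x K - xs)"
  proof -
    obtain w where w: "w \<in> closed_segment (x K) xs"
      "norm (F (x K) - F xs) \<le> (L0 + L1 * norm (F w) powr \<alpha>) * norm (x K - xs)"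
      using alpha_symmetric_Lipschitz_segment [OF lip \<alpha>(1), of "x K" xs] by metis
    have "norm (w - xs) \<le> R"
      using segment_bound(2) [OF w(1)] dist_le [of K] by (simp add: norm_minus_commute)
    then have "(L0 + L1 * norm (F w) powr \<alpha>) * norm (x K - xs) \<le> (L0 + L1 * X) * norm (x K - xs)"
      using L F_le by (intro mult_right_mono add_left_mono mult_left_mono) auto
    with w(2) root have "4 * g * norm (F (x K)) \<le> 4 * g * ((L0 + L1 * X) * norm (x K - xs))"
      using g by (intro mult_left_mono) auto
    also have "\<dots> \<le> 1 * norm (x K - xs)"
    proof -
      have "4 * g * (L0 + L1 * X) \<le> 1"
        using small [of X] X den_pos [OF X] by (simp add: g_def pos_divide_le_eq)
      then show ?thesis unfolding mult.assoc [symmetric] by (intro mult_right_mono) auto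
    qed
    finally show ?thesis by simp
  qed
  have rate: "9 / 8 * (real K + 1) * (g\<^sup>2 * (norm (F (x K)))\<^sup>2) \<le> R\<^sup>2"
    unfolding R_def using step g_le
    by (intro extragradient_last_iterate_rate [OF mono root eg g _ _ _ last]) auto
  \<comment> \<open>The factor \<open>3 / 2\<close> between \<open>1 / g\<close> and \<open>2 sqrt 2 B\<close> enters squared, and
    \<open>8 (3 / 2)\<^sup>2 / (9 / 8) = 16\<close>.\<close>
  define B where "B = K0 + (K1 + 2 powr (- (3 / 2)) * K2 powr (1 - \<alpha>)) * X"
  have "2 * sqrt 2 * K0 \<le> 3 * sqrt 2 * K0" using K0 by (intro mult_right_mono) auto
  then have "1 / g \<le> 3 * sqrt 2 * B"
    using mult_right_mono [OF C(3), of X] X by (simp add: g_def B_def algebra_simps)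
  then have "(1 / g)\<^sup>2 \<le> (3 * sqrt 2 * B)\<^sup>2" using g by (intro power_mono) auto
  then have gB: "1 \<le> 18 * B\<^sup>2 * g\<^sup>2" using g by (simp add: power_mult_distrib power_divide field_simps)
  have "(real K + 1) * (norm (F (x K)))\<^sup>2 * 1 \<le> (real K + 1) * (norm (F (x K)))\<^sup>2 * (18 * B\<^sup>2 * g\<^sup>2)"
    using gB by (intro mult_left_mono) auto
  also have "\<dots> = 16 * B\<^sup>2 * (9 / 8 * (real K + 1) * (g\<^sup>2 * (norm (F (x K)))\<^sup>2))" by simp
  also have "\<dots> \<le> 16 * B\<^sup>2 * R\<^sup>2" using rate by (intro mult_left_mono) auto
  finally have "(norm (F (x K)))\<^sup>2 \<le> 16 * B\<^sup>2 * R\<^sup>2 / (real K + 1)"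
    by (simp add: field_simps)
  moreover have "?min \<le> (norm (F (x K)))\<^sup>2" by (intro Min_le) auto
  ultimately have "?min \<le> 16 * B\<^sup>2 * R\<^sup>2 / (real K + 1)" by linarith
  then show ?thesis by (simp only: B_def X_def R_def mult.assoc)
qed

end
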